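(* Suppose $n\ge2$ and $1\le m\le n$, let $w=e^{-i\frac{2\pi}{n}}$ and let $\beta>0$. For a skew-Hermitian matrix $A\in\mathbb{C}^{n\times n}$ with orthonormal eigenvector basis $v_1,\dots,v_n$ (see context), let $\widehat B\in\mathbb{C}^{n\times m}$ be the matrix which, represented in the basis $\{v_j\}$ of $\mathbb{C}^n$ (and the standard basis of $\mathbb{C}^m$), has entries $$\widehat B_{j,l}=\frac{\beta}{\sqrt n}\,w^{(j-1)(l-1)},\qquad 1\le j\le n,\ 1\le l\le m.$$ Then $\|\widehat B\|=\beta$, and for any $\varepsilon>0$ there exists $K>0$ such that if $\delta(A)>K$, then $$\Bigl(\sup_{\|B\|=\beta}\gamma_{\mathrm{decay}}(A,B)\Bigr)-\gamma_{\mathrm{decay}}(A,\widehat B)<\varepsilon.$$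
   Context: $\|\cdot\|$ is the Euclidean norm of vectors and the induced operator norm of matrices. For a skew-Hermitian $A\in\mathbb{C}^{n\times n}$ ($A^*=-A$), the eigenvalues listed with multiplicity are $i\lambda_1,\dots,i\lambda_n$ with $\lambda_1\le\dots\le\lambda_n$ real, $v_1,\dots,v_n$ is an orthonormal basis of $\mathbb{C}^n$ with $Av_j=i\lambda_jv_j$, and $\delta(A)=\min_{j\ne k}|\lambda_j-\lambda_k|$. The constant $K$ depends only on $n,m,\beta,\varepsilon$, not on $A$. For $B\in\mathbb{C}^{n\times m}$ with $\ker B=\{0\}$ and $(A,B)$ stabilizable, $\gamma_{\mathrm{decay}}(A,B)$ is defined via the linear quadratic regulator problem of minimizing $\int_0^\infty x(t)^*x(t)+u(t)^*u(t)\,dt$ subject to $x'=Ax+Bu$, $x(0)=x_0$: the optimal control is $u=-B^*Xx$, where $X$ is the unique nonnegative solution of $XBB^*X-XA-A^*X-I=0$, the closed-loop matrix $A_{\mathrm{cl.loop}}=A-BB^*X$ is stable, and $\gamma_{\mathrm{decay}}(A,B)=\min\{|\operatorname{Re}\nu|:\nu\text{ an eigenvalue of }A_{\mathrm{cl.loop}}\}$. The supremum is taken over all such $B\in\mathbb{C}^{n\times m}$ (with $\ker B=\{0\}$ and $(A,B)$ stabilizable) with $\|B\|=\beta$. *)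

theory Defs
  imports
    Complex_Main
    "HOL-Library.Extended_Real"
    "Jordan_Normal_Form.Schur_Decomposition"
    "Jordan_Normal_Form.Spectral_Radius"
    "Jordan_Normal_Form.Matrix_Kernel"
begin

definition vec_norm2 :: "complex vec \<Rightarrow> real" where
  "vec_norm2 x = sqrt (\<Sum>i<dim_vec x. (cmod (x $ i))\<^sup>2)"

definition op_norm :: "complex mat \<Rightarrow> real" where
  "op_norm B = Sup {vec_norm2 (B *\<^sub>v x) | x. x \<in> carrier_vec (dim_col B) \<and> vec_norm2 x \<le> 1}"

definition skew_hermitian :: "complex mat \<Rightarrow> bool" where
  "skew_hermitian A \<longleftrightarrow> square_mat A \<and> mat_adjoint A = - A"

text \<open>The real numbers \<open>lam 0 \<le> \<dots> \<le> lam (n - 1)\<close> are the eigenvalues of \<open>A / \<i>\<close> with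
  multiplicity, and \<open>v 0, \<dots>, v (n - 1)\<close> is an orthonormal basis of corresponding eigenvectors.
  All indices start at 0; values of \<open>lam\<close> and \<open>v\<close> at indices \<open>\<ge> n\<close> are irrelevant.\<close>

definition eigenbasis :: "nat \<Rightarrow> complex mat \<Rightarrow> (nat \<Rightarrow> real) \<Rightarrow> (nat \<Rightarrow> complex vec) \<Rightarrow> bool" where
  "eigenbasis n A lam v \<longleftrightarrow>
     (\<forall>i j. i \<le> j \<and> j < n \<longrightarrow> lam i \<le> lam j) \<and>
     (\<forall>j<n. v j \<in> carrier_vec n \<and> A *\<^sub>v v j = (\<i> * complex_of_real (lam j)) \<cdot>\<^sub>v v j) \<and>
     (\<forall>j<n. \<forall>k<n. v j \<bullet>c v k = (if j = k then 1 else 0))"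

definition spectral_gap :: "nat \<Rightarrow> (nat \<Rightarrow> real) \<Rightarrow> real" where
  "spectral_gap n lam = Min {\<bar>lam j - lam k\<bar> | j k. j < n \<and> k < n \<and> j \<noteq> k}"

definition stable :: "complex mat \<Rightarrow> bool" where
  "stable M \<longleftrightarrow> (\<forall>\<nu>. eigenvalue M \<nu> \<longrightarrow> Re \<nu> < 0)"

definition stabilizable :: "complex mat \<Rightarrow> complex mat \<Rightarrow> bool" where
  "stabilizable A B \<longleftrightarrow> (\<exists>F \<in> carrier_mat (dim_col B) (dim_row B). stable (A + B * F))"

definition nonnegative_mat :: "complex mat \<Rightarrow> bool" where
  "nonnegative_mat X \<longleftrightarrow> square_mat X \<and> mat_adjoint X = X \<and>
     (\<forall>x \<in> carrier_vec (dim_row X). 0 \<le> Re ((X *\<^sub>v x) \<bullet>c x))"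

definition riccati_solution :: "complex mat \<Rightarrow> complex mat \<Rightarrow> complex mat \<Rightarrow> bool" where
  "riccati_solution A B X \<longleftrightarrow>
     X \<in> carrier_mat (dim_row A) (dim_row A) \<and>
     X * B * mat_adjoint B * X - X * A - mat_adjoint A * X - 1\<^sub>m (dim_row A)
       = 0\<^sub>m (dim_row A) (dim_row A)"

text \<open>\<open>lqr_X A B\<close> gives the optimal feedback \<open>u = - B\<^sup>* X x\<close> of the regulator problem of minimizing
  the integral of \<open>x\<^sup>* x + u\<^sup>* u\<close> over \<open>[0, \<infinity>)\<close> subject to \<open>x' = A x + B u\<close>. It is only
  meaningful if \<open>(A, B)\<close> is stabilizable, when the nonnegative solution exists and is unique.\<close>

definition lqr_X :: "complex mat \<Rightarrow> complex mat \<Rightarrow> complex mat" where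
  "lqr_X A B = (THE X. nonnegative_mat X \<and> riccati_solution A B X)"

definition closed_loop :: "complex mat \<Rightarrow> complex mat \<Rightarrow> complex mat" where
  "closed_loop A B = A - B * mat_adjoint B * lqr_X A B"

definition gamma_decay :: "complex mat \<Rightarrow> complex mat \<Rightarrow> real" where
  "gamma_decay A B = Min ((\<lambda>\<nu>. \<bar>Re \<nu>\<bar>) ` spectrum (closed_loop A B))"

definition admissible :: "nat \<Rightarrow> nat \<Rightarrow> complex mat \<Rightarrow> complex mat set" where
  "admissible n m A = {B \<in> carrier_mat n m. mat_kernel B = {0\<^sub>v m} \<and> stabilizable A B}"

text \<open>The left factor, whose columns are the \<open>v j\<close>, changes from coordinates in the basis
  \<open>v 0, \<dots>, v (n - 1)\<close> to standard coordinates. With indices starting at 0, the exponent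
  \<open>(j - 1) (l - 1)\<close> becomes \<open>j * l\<close>.\<close>

definition B_hat :: "nat \<Rightarrow> nat \<Rightarrow> real \<Rightarrow> (nat \<Rightarrow> complex vec) \<Rightarrow> complex mat" where
  "B_hat n m \<beta> v =
     (let w = exp (- (\<i> * complex_of_real (2 * pi / real n)))
      in mat_of_cols n (map v [0..<n]) *
         mat n m (\<lambda>(j, l). complex_of_real (\<beta> / sqrt (real n)) * w ^ (j * l)))"

end

theory Submission
  imports Defs "HOL-Analysis.L2_Norm"
begin

text \<open>Put \<open>r = \<beta> (m / n)\<^sup>1\<^sup>/\<^sup>2\<close>. The trace of the Riccati equation of a skew-Hermitian \<open>A\<close> is
  \<open>tr (X B B\<^sup>* X) = n\<close>. The trace of the closed loop matrix is therefore bounded, by Cauchy-Schwarz and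
  \<open>tr (B\<^sup>* B) \<le> m \<beta>\<^sup>2\<close>, and this gives \<open>\<gamma> \<le> r\<close> for every admissible \<open>B\<close> of norm \<open>\<beta>\<close>, whatever the gap is.
  In the eigenbasis, the rows of the scaled discrete Fourier matrix have norm \<open>r\<close>. For a large gap, \<open>X\<close> is
  close to \<open>1 / r\<close>, and the eigenvalues of the closed loop matrix are close to \<open>\<i> \<lambda>\<^sub>j - r\<close>. It remains to know
  that the Riccati equation has exactly one nonnegative solution. Existence comes from the Newton-Kleinman
  iteration, started at a supersolution, and uniqueness from the Sylvester equation satisfied by the
  difference of two solutions.\<close>

section \<open>Matrices, adjoints and positive semidefiniteness\<close>

text \<open>The Fourier matrix does two things at once. Its orthogonal columns of length \<beta>
  make \<open>tr (B\<^sup>* B) = m \<beta>\<^sup>2\<close>, the largest value that the norm allows,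
  and its entries of equal modulus give every eigenvector the same share \<open>r\<^sup>2\<close> of
  it. For a large gap, feedback moves the eigenvalue near \<open>\<i> \<lambda>\<^sub>j\<close> to
  the left by about the length of row \<open>j\<close>, so unequal rows would leave one eigenvalue
  slower than the average.

  The obstacle is uniformity: the estimates may depend on \<open>A\<close> only through its gap. In
  the eigenbasis, the terms with \<open>A\<close> drop out of the diagonal of the Riccati equation,
  which fixes the lengths of the columns of \<open>B\<^sup>* X\<close> exactly, for any gap. All
  estimates start from these unit vectors, so the error is an explicit constant divided by the gap,
  and \<open>K\<close> can be written down.

  As \<open>lqr_X\<close> is a definite description, nothing can be said about
  \<open>gamma_decay\<close> before existence and uniqueness are known. Both are obtained from
  monotone bounded sequences of matrices and from triangular forms, without integrals or matrix
  exponentials.\<close>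

lemma dim_adjoint [simp]:
  "dim_row (mat_adjoint A) = dim_col A" "dim_col (mat_adjoint A) = dim_row A"
  by (simp_all add: mat_adjoint_def)

lemma adjoint_carrier [simp]: "mat_adjoint A \<in> carrier_mat n m \<longleftrightarrow> A \<in> carrier_mat m n"
  unfolding carrier_mat_def by auto

lemma index_adjoint [simp]:
  fixes A :: "complex mat"
  shows "i < dim_col A \<Longrightarrow> j < dim_row A \<Longrightarrow> mat_adjoint A $$ (i, j) = cnj (A $$ (j, i))"
  by (simp add: mat_adjoint_def mat_of_rows_def)

lemma index_mult_sum:
  "i < dim_row A \<Longrightarrow> j < dim_col B \<Longrightarrow> dim_col A = dim_row B \<Longrightarrow>
   (A * B) $$ (i, j) = (\<Sum>k<dim_row B. A $$ (i, k) * B $$ (k, j))"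
  by (simp add: scalar_prod_def atLeast0LessThan)

lemma index_mult_vec_sum:
  "i < dim_row A \<Longrightarrow> dim_col A = dim_vec x \<Longrightarrow>
   (A *\<^sub>v x) $ i = (\<Sum>k<dim_vec x. A $$ (i, k) * x $ k)"
  by (simp add: scalar_prod_def atLeast0LessThan)

lemma cscalar_sum:
  fixes x y :: "complex vec"
  shows "x \<bullet>c y = (\<Sum>i<dim_vec y. x $ i * cnj (y $ i))"
  by (simp add: scalar_prod_def atLeast0LessThan)

lemma adjoint_add:
  fixes A :: "complex mat"
  shows "dim_row A = dim_row B \<Longrightarrow> dim_col A = dim_col B \<Longrightarrow>
    mat_adjoint (A + B) = mat_adjoint A + mat_adjoint B"
  by (rule eq_matI) auto

lemma adjoint_minus:
  fixes A :: "complex mat"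
  shows "dim_row A = dim_row B \<Longrightarrow> dim_col A = dim_col B \<Longrightarrow>
    mat_adjoint (A - B) = mat_adjoint A - mat_adjoint B"
  by (rule eq_matI) auto

lemma adjoint_uminus: "mat_adjoint (- A) = - mat_adjoint (A :: complex mat)"
  by (rule eq_matI) auto

lemma adjoint_smult: "mat_adjoint (c \<cdot>\<^sub>m A) = cnj c \<cdot>\<^sub>m mat_adjoint (A :: complex mat)"
  by (rule eq_matI) auto

lemma adjoint_mult:
  fixes A :: "complex mat"
  shows "dim_col A = dim_row B \<Longrightarrow> mat_adjoint (A * B) = mat_adjoint B * mat_adjoint A"
  by (rule eq_matI) (simp_all add: index_mult_sum mult.commute del: index_mult_mat(1))

lemma adjoint_adjoint [simp]: "mat_adjoint (mat_adjoint A) = (A :: complex mat)"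
  by (rule eq_matI) auto

lemma adjoint_one [simp]: "mat_adjoint (1\<^sub>m n) = (1\<^sub>m n :: complex mat)"
  by (rule eq_matI) auto

text \<open>Hypotheses on dimensions, in place of membership in \<open>carrier_mat\<close>, leave no
  size to be guessed, so this and the next laws work as conditional rewrite rules.\<close>

lemma mult_assoc_dim:
  "dim_col A = dim_row B \<Longrightarrow> dim_col B = dim_row C \<Longrightarrow> (A * B) * C = A * (B * (C :: complex mat))"
  by (rule assoc_mult_mat) auto

lemma add_mult_dim:
  fixes C :: "complex mat"
  shows "dim_row A = dim_row B \<Longrightarrow> dim_col A = dim_col B \<Longrightarrow> dim_col B = dim_row C \<Longrightarrow>
    (A + B) * C = A * C + B * C"
  by (rule add_mult_distrib_mat) auto

lemma mult_add_dim:
  fixes C :: "complex mat"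
  shows "dim_row A = dim_row B \<Longrightarrow> dim_col A = dim_col B \<Longrightarrow> dim_col C = dim_row B \<Longrightarrow>
    C * (A + B) = C * A + C * B"
  by (rule mult_add_distrib_mat) auto

lemma minus_mult_dim:
  fixes C :: "complex mat"
  shows "dim_row A = dim_row B \<Longrightarrow> dim_col A = dim_col B \<Longrightarrow> dim_col B = dim_row C \<Longrightarrow>
    (A - B) * C = A * C - B * C"
  by (rule minus_mult_distrib_mat) auto

lemma mult_minus_dim:
  fixes C :: "complex mat"
  shows "dim_row A = dim_row B \<Longrightarrow> dim_col A = dim_col B \<Longrightarrow> dim_col C = dim_row B \<Longrightarrow>
    C * (A - B) = C * A - C * B"
  by (rule mult_minus_distrib_mat) auto

lemma uminus_mult_dim:
  fixes A :: "complex mat"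
  shows "dim_col A = dim_row B \<Longrightarrow> - A * B = - (A * B)" "dim_col A = dim_row B \<Longrightarrow> A * - B = - (A * B)"
  by simp_all

lemma smult_mult_dim:
  fixes A :: "complex mat"
  shows "dim_col A = dim_row B \<Longrightarrow> (c \<cdot>\<^sub>m A) * B = c \<cdot>\<^sub>m (A * B)"
    "dim_col A = dim_row B \<Longrightarrow> A * (c \<cdot>\<^sub>m B) = c \<cdot>\<^sub>m (A * B)"
  by (auto intro!: mult_smult_assoc_mat mult_smult_distrib)

text \<open>The normal form is a sum of right-nested products with adjoints on single factors.
  Matrix identities are then checked entrywise by \<open>algebra_simps\<close>, with
  \<open>index_mult_mat(1)\<close> removed so that entries of products stay atoms.\<close>

lemmas mat_expand = mult_assoc_dim add_mult_dim mult_add_dim minus_mult_dim mult_minus_dim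
  uminus_mult_dim smult_mult_dim adjoint_add adjoint_minus adjoint_uminus adjoint_smult adjoint_mult

lemma mult_vec_assoc_dim:
  "dim_col A = dim_row B \<Longrightarrow> dim_col B = dim_vec x \<Longrightarrow> (A * B) *\<^sub>v x = A *\<^sub>v (B *\<^sub>v (x :: complex vec))"
  by (rule assoc_mult_mat_vec) auto

lemma add_mult_vec_dim:
  fixes x :: "complex vec"
  shows "dim_row A = dim_row B \<Longrightarrow> dim_col A = dim_col B \<Longrightarrow> dim_col B = dim_vec x \<Longrightarrow>
    (A + B) *\<^sub>v x = A *\<^sub>v x + B *\<^sub>v x"
  by (rule add_mult_distrib_mat_vec) auto

lemma minus_mult_vec_dim:
  fixes x :: "complex vec"
  shows "dim_row A = dim_row B \<Longrightarrow> dim_col A = dim_col B \<Longrightarrow> dim_col B = dim_vec x \<Longrightarrow>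
    (A - B) *\<^sub>v x = A *\<^sub>v x - B *\<^sub>v x"
  by (rule minus_mult_distrib_mat_vec) auto

lemma uminus_mult_vec_dim:
  fixes x :: "complex vec"
  shows "dim_col A = dim_vec x \<Longrightarrow> (- A) *\<^sub>v x = - (A *\<^sub>v x)"
  by simp

lemma smult_mult_vec_dim:
  fixes x :: "complex vec"
  shows "dim_col A = dim_vec x \<Longrightarrow> (c \<cdot>\<^sub>m A) *\<^sub>v x = c \<cdot>\<^sub>v (A *\<^sub>v x)"
    "dim_col A = dim_vec x \<Longrightarrow> A *\<^sub>v (c \<cdot>\<^sub>v x) = c \<cdot>\<^sub>v (A *\<^sub>v x)"
  by (rule eq_vecI; simp add: index_mult_vec_sum sum_distrib_left mult_ac del: index_mult_mat_vec)+

lemmas vec_expand = mult_vec_assoc_dim add_mult_vec_dim minus_mult_vec_dim uminus_mult_vec_dim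
  smult_mult_vec_dim

lemma adjoint_cscalar:
  fixes A :: "complex mat"
  assumes "dim_vec u = dim_row A" "dim_vec x = dim_col A"
  shows "(mat_adjoint A *\<^sub>v u) \<bullet>c x = u \<bullet>c (A *\<^sub>v x)"
proof -
  have "(mat_adjoint A *\<^sub>v u) \<bullet>c x = (\<Sum>i<dim_vec x. \<Sum>k<dim_vec u. cnj (A $$ (k, i)) * u $ k * cnj (x $ i))"
    using assms by (simp add: cscalar_sum index_mult_vec_sum sum_distrib_right del: index_mult_mat_vec)
  also have "\<dots> = (\<Sum>k<dim_vec u. \<Sum>i<dim_vec x. cnj (A $$ (k, i)) * u $ k * cnj (x $ i))"
    by (rule sum.swap)
  also have "\<dots> = u \<bullet>c (A *\<^sub>v x)"
    using assms by (simp add: cscalar_sum index_mult_vec_sum sum_distrib_left mult_ac del: index_mult_mat_vec)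
  finally show ?thesis .
qed

lemma cscalar_linear:
  fixes x y z :: "complex vec"
  shows "dim_vec x = dim_vec z \<Longrightarrow> dim_vec y = dim_vec z \<Longrightarrow> (x + y) \<bullet>c z = x \<bullet>c z + y \<bullet>c z"
    "dim_vec x = dim_vec z \<Longrightarrow> dim_vec y = dim_vec z \<Longrightarrow> (x - y) \<bullet>c z = x \<bullet>c z - y \<bullet>c z"
    "dim_vec x = dim_vec z \<Longrightarrow> (- x) \<bullet>c z = - (x \<bullet>c z)"
    "dim_vec x = dim_vec z \<Longrightarrow> (c \<cdot>\<^sub>v x) \<bullet>c z = c * (x \<bullet>c z)"
    "dim_vec x = dim_vec z \<Longrightarrow> x \<bullet>c (c \<cdot>\<^sub>v z) = cnj c * (x \<bullet>c z)"
  by (simp_all add: cscalar_sum sum.distrib sum_subtractf sum_negf distrib_right left_diff_distrib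
      sum_distrib_left mult.assoc mult.left_commute)

lemma cscalar_self:
  "x \<bullet>c x = complex_of_real (\<Sum>i<dim_vec x. (cmod (x $ i))\<^sup>2)"
  unfolding cscalar_sum of_real_sum complex_norm_square ..

lemma Re_cscalar_self_nonneg: "0 \<le> Re (x \<bullet>c (x :: complex vec))"
  by (simp only: cscalar_self) (simp add: sum_nonneg)

section \<open>The semidefinite order\<close>

text \<open>This is \<open>nonnegative_mat\<close> with the size as a parameter;
  \<open>psd n (Z - Y)\<close> serves as the order \<open>Y \<le> Z\<close>.\<close>

definition psd :: "nat \<Rightarrow> complex mat \<Rightarrow> bool" where
  "psd n Z \<longleftrightarrow> Z \<in> carrier_mat n n \<and> mat_adjoint Z = Z \<and>
     (\<forall>x \<in> carrier_vec n. 0 \<le> Re ((Z *\<^sub>v x) \<bullet>c x))"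

lemma psd_iff_nonnegative: "psd n Z \<longleftrightarrow> Z \<in> carrier_mat n n \<and> nonnegative_mat Z"
  by (auto simp: psd_def nonnegative_mat_def)

lemma psd_carrier: "psd n Z \<Longrightarrow> Z \<in> carrier_mat n n"
  and psd_dim: "psd n Z \<Longrightarrow> dim_row Z = n" "psd n Z \<Longrightarrow> dim_col Z = n"
  and psd_adjoint: "psd n Z \<Longrightarrow> mat_adjoint Z = Z"
  and psd_form: "psd n Z \<Longrightarrow> dim_vec x = n \<Longrightarrow> 0 \<le> Re ((Z *\<^sub>v x) \<bullet>c x)"
  by (auto simp: psd_def intro: carrier_vecI)

lemma psdI:
  assumes "dim_row Z = n" "dim_col Z = n" "mat_adjoint Z = Z"
    and "\<And>x. dim_vec x = n \<Longrightarrow> 0 \<le> Re ((Z *\<^sub>v x) \<bullet>c x)"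
  shows "psd n Z"
  using assms by (auto simp: psd_def)

lemma psd_zero: "psd n (0\<^sub>m n n)"
  by (rule psdI) (auto simp: cscalar_sum index_mult_vec_sum simp del: index_mult_mat_vec)

lemma psd_one: "psd n (1\<^sub>m n)"
proof (rule psdI)
  fix x :: "complex vec"
  assume "dim_vec x = n"
  hence "1\<^sub>m n *\<^sub>v x = x" by (intro one_mult_mat_vec) auto
  thus "0 \<le> Re ((1\<^sub>m n *\<^sub>v x) \<bullet>c x)" using Re_cscalar_self_nonneg[of x] by simp
qed auto

lemma psd_add:
  assumes "psd n Y" "psd n Z"
  shows "psd n (Y + Z)"
  using assms
  by (intro psdI) (auto simp: psd_dim psd_adjoint psd_form vec_expand mat_expand cscalar_linear)

lemma psd_smult:
  assumes "psd n Z" "0 \<le> c"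
  shows "psd n (complex_of_real c \<cdot>\<^sub>m Z)"
  using assms
  by (intro psdI) (auto simp: psd_dim psd_adjoint psd_form vec_expand mat_expand cscalar_linear)

lemma psd_congruence:
  assumes "psd n Z" "S \<in> carrier_mat n m"
  shows "psd m (mat_adjoint S * Z * S)"
  using assms
  by (intro psdI)
    (auto simp: psd_dim psd_adjoint psd_form vec_expand mat_expand adjoint_cscalar)

lemma psd_gram:
  assumes "S \<in> carrier_mat n m"
  shows "psd m (mat_adjoint S * S)"
  using psd_congruence[OF psd_one assms] assms by (simp add: mat_expand)

lemma psd_le_trans:
  assumes "psd n (Y - X)" "psd n (Z - Y)" "X \<in> carrier_mat n n" "Y \<in> carrier_mat n n"
  shows "psd n (Z - X)"
proof -
  have "Z - Y \<in> carrier_mat n n" "Y - X \<in> carrier_mat n n" using assms psd_carrier by auto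
  hence "Z - X = (Z - Y) + (Y - X)" using assms(3,4) by (intro eq_matI) auto
  thus ?thesis using psd_add[OF assms(2,1)] by simp
qed

lemma psd_telescope:
  assumes "\<And>k. S k \<in> carrier_mat n n" "\<And>k. psd n (S (Suc k) - S k)" "k \<le> l"
  shows "psd n (S l - S k)"
  using assms(3)
proof (induction l rule: dec_induct)
  case base
  have "S k - S k = 0\<^sub>m n n" using assms(1)[of k] by (intro eq_matI) auto
  thus ?case using psd_zero by simp
next
  case (step l)
  show ?case by (rule psd_le_trans[OF step.IH assms(2)]) (use assms in auto)
qed

section \<open>Trace and entries of semidefinite matrices\<close>

definition tr :: "complex mat \<Rightarrow> complex" where
  "tr A = (\<Sum>i<dim_row A. A $$ (i, i))"

lemma tr_mult_commute:
  assumes "dim_col A = dim_row B" "dim_row A = dim_col B"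
  shows "tr (A * B) = tr (B * A)"
proof -
  have "tr (A * B) = (\<Sum>i<dim_row A. \<Sum>k<dim_row B. A $$ (i, k) * B $$ (k, i))"
    using assms by (simp add: tr_def index_mult_sum del: index_mult_mat(1))
  also have "\<dots> = (\<Sum>k<dim_row B. \<Sum>i<dim_row A. A $$ (i, k) * B $$ (k, i))"
    by (rule sum.swap)
  also have "\<dots> = tr (B * A)"
    using assms by (simp add: tr_def index_mult_sum mult.commute del: index_mult_mat(1))
  finally show ?thesis .
qed

lemma tr_linear:
  "dim_row A = dim_row B \<Longrightarrow> dim_col A = dim_col B \<Longrightarrow> dim_row B = dim_col B \<Longrightarrow> tr (A + B) = tr A + tr B"
  "dim_row A = dim_row B \<Longrightarrow> dim_col A = dim_col B \<Longrightarrow> dim_row B = dim_col B \<Longrightarrow> tr (A - B) = tr A - tr B"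
  "dim_row A = dim_col A \<Longrightarrow> tr (- A) = - tr A"
  by (simp_all add: tr_def sum.distrib sum_subtractf sum_negf)

lemma hermitian_entry:
  fixes Z :: "complex mat"
  assumes "mat_adjoint Z = Z" "i < dim_row Z" "j < dim_row Z"
  shows "Z $$ (j, i) = cnj (Z $$ (i, j))"
  by (metis assms dim_adjoint(1) index_adjoint)

lemma form_sum:
  assumes "Z \<in> carrier_mat n n" "dim_vec x = n"
  shows "(Z *\<^sub>v x) \<bullet>c x = (\<Sum>i<n. \<Sum>j<n. Z $$ (i, j) * x $ j * cnj (x $ i))"
  using assms by (simp add: cscalar_sum index_mult_vec_sum sum_distrib_right del: index_mult_mat_vec)

lemma psd_diag_nonneg:
  assumes "psd n Z" "i < n"
  shows "0 \<le> Re (Z $$ (i, i))"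
proof -
  have sum1: "(\<Sum>k<n. f k * unit_vec n i $ k) = f i" for f :: "nat \<Rightarrow> complex"
  proof -
    have "(\<Sum>k<n. f k * unit_vec n i $ k) = (\<Sum>k\<in>{i}. f k * unit_vec n i $ k)"
      by (rule sum.mono_neutral_right) (use assms in auto)
    thus ?thesis using assms by simp
  qed
  have sum1': "(\<Sum>k<n. f k * cnj (unit_vec n i $ k)) = f i" for f :: "nat \<Rightarrow> complex"
    using arg_cong[OF sum1[of "\<lambda>k. cnj (f k)"], of cnj] by simp
  have "(Z *\<^sub>v unit_vec n i) \<bullet>c unit_vec n i = Z $$ (i, i)"
    by (simp add: form_sum[OF psd_carrier[OF assms(1)]] sum_distrib_right[symmetric] sum1 sum1')
  thus ?thesis
    using psd_form[OF assms(1), of "unit_vec n i"] by simp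
qed

text \<open>Convergence of monotone sequences needs control of all entries, and the trace provides
  it. A test vector with entry 1 at \<open>i\<close> and a unimodular \<open>c\<close> at
  \<open>j\<close> aligns the phases, so that the form becomes the sum of the two diagonal entries
  minus \<open>2 * cmod (Z $$ (i, j))\<close>.\<close>

lemma psd_entry_le:
  assumes Z: "psd n Z" and i: "i < n" and j: "j < n"
  shows "cmod (Z $$ (i, j)) \<le> Re (tr Z)"
proof -
  have tr: "Re (tr Z) = (\<Sum>k<n. Re (Z $$ (k, k)))"
    using psd_dim[OF Z] by (simp add: tr_def)
  have real: "Z $$ (k, k) = complex_of_real (Re (Z $$ (k, k)))" if "k < n" for k
    using hermitian_entry[OF psd_adjoint[OF Z], of k k] that psd_dim[OF Z]
    by (simp add: complex_eq_iff)
  show ?thesis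
  proof (cases "i = j")
    case True
    have "cmod (Z $$ (i, i)) = Re (Z $$ (i, i))"
      using real[OF i] psd_diag_nonneg[OF Z i] by (metis norm_of_real abs_of_nonneg)
    also have "\<dots> \<le> Re (tr Z)"
      unfolding tr by (rule member_le_sum) (use i psd_diag_nonneg[OF Z] in auto)
    finally show ?thesis using True by simp
  next
    case False
    \<comment> \<open>The zero entry is a separate case because \<open>sgn 0 = 0\<close> would spoil
      \<open>c * cnj c = 1\<close>.\<close>
    define c where "c = (if Z $$ (i, j) = 0 then 1 else - cnj (sgn (Z $$ (i, j))))"
    define x where "x = vec n (\<lambda>k. if k = i then 1 else if k = j then c else 0)"
    have c1: "c * cnj c = 1"
      unfolding complex_norm_square[symmetric] by (simp add: c_def norm_sgn)
    have c2: "Z $$ (i, j) * c = - complex_of_real (cmod (Z $$ (i, j)))"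
    proof (cases "Z $$ (i, j) = 0")
      case False
      hence "Z $$ (i, j) * c = - (Z $$ (i, j) * cnj (Z $$ (i, j)) / complex_of_real (cmod (Z $$ (i, j))))"
        by (simp add: c_def sgn_eq)
      also have "\<dots> = - complex_of_real (cmod (Z $$ (i, j)))"
        unfolding complex_norm_square[symmetric] using False by (simp add: power2_eq_square)
      finally show ?thesis .
    qed (simp add: c_def)
    have sum2: "(\<Sum>k<n. f k * x $ k) = f i + f j * c" for f :: "nat \<Rightarrow> complex"
    proof -
      have "(\<Sum>k<n. f k * x $ k) = (\<Sum>k\<in>{i, j}. f k * x $ k)"
        by (rule sum.mono_neutral_right) (use i j in \<open>auto simp: x_def\<close>)
      thus ?thesis using False i j by (simp add: x_def)
    qed
    have sum2': "(\<Sum>k<n. f k * cnj (x $ k)) = f i + f j * cnj c" for f :: "nat \<Rightarrow> complex"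
      using arg_cong[OF sum2[of "\<lambda>k. cnj (f k)"], of cnj] by simp
    have "(Z *\<^sub>v x) \<bullet>c x = (\<Sum>a<n. (\<Sum>b<n. Z $$ (a, b) * x $ b) * cnj (x $ a))"
      by (subst form_sum[OF psd_carrier[OF Z]]) (simp_all add: x_def sum_distrib_right)
    also have "\<dots> = Z $$ (i, i) + Z $$ (i, j) * c + (Z $$ (j, i) + Z $$ (j, j) * c) * cnj c"
      by (simp add: sum2 sum2')
    also have "\<dots> = Z $$ (i, i) + Z $$ (j, j) * (c * cnj c) + Z $$ (i, j) * c + cnj (Z $$ (i, j) * c)"
      using hermitian_entry[OF psd_adjoint[OF Z], of i j] i j psd_dim[OF Z]
      by (simp add: algebra_simps)
    also have "Re \<dots> = Re (Z $$ (i, i)) + Re (Z $$ (j, j)) - 2 * cmod (Z $$ (i, j))"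
      by (simp add: c1 c2 del: complex_cnj_mult)
    finally have "2 * cmod (Z $$ (i, j)) \<le> Re (Z $$ (i, i)) + Re (Z $$ (j, j))"
      using psd_form[OF Z, of x] by (simp add: x_def)
    also have "\<dots> = (\<Sum>k\<in>{i, j}. Re (Z $$ (k, k)))" using False by simp
    also have "\<dots> \<le> Re (tr Z)"
      unfolding tr by (rule sum_mono2) (use i j psd_diag_nonneg[OF Z] in auto)
    finally show ?thesis using norm_ge_zero[of "Z $$ (i, j)"] by linarith
  qed
qed

lemma psd_tr_nonneg: "psd n Z \<Longrightarrow> 0 \<le> Re (tr Z)"
  using psd_diag_nonneg[of n Z] psd_dim[of n Z] by (auto simp: tr_def intro!: sum_nonneg)

section \<open>Lyapunov equations\<close>

definition mat_tendsto :: "nat \<Rightarrow> (nat \<Rightarrow> complex mat) \<Rightarrow> complex mat \<Rightarrow> bool" where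
  "mat_tendsto n S L \<longleftrightarrow> L \<in> carrier_mat n n \<and> (\<forall>k. S k \<in> carrier_mat n n) \<and>
     (\<forall>i<n. \<forall>j<n. (\<lambda>k. S k $$ (i, j)) \<longlonglongrightarrow> L $$ (i, j))"

lemma mat_tendstoD:
  assumes "mat_tendsto n S L"
  shows "dim_row L = n" "dim_col L = n" "dim_row (S k) = n" "dim_col (S k) = n"
    "i < n \<Longrightarrow> j < n \<Longrightarrow> (\<lambda>k. S k $$ (i, j)) \<longlonglongrightarrow> L $$ (i, j)"
  using assms by (auto simp: mat_tendsto_def)

lemma mat_tendstoI:
  assumes "dim_row L = n" "dim_col L = n" "\<And>k. dim_row (S k) = n" "\<And>k. dim_col (S k) = n"
    "\<And>i j. i < n \<Longrightarrow> j < n \<Longrightarrow> (\<lambda>k. S k $$ (i, j)) \<longlonglongrightarrow> L $$ (i, j)"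
  shows "mat_tendsto n S L"
  using assms by (auto simp: mat_tendsto_def)

lemma mat_tendsto_const: "L \<in> carrier_mat n n \<Longrightarrow> mat_tendsto n (\<lambda>k. L) L"
  by (auto simp: mat_tendsto_def)

lemma mat_tendsto_add:
  "mat_tendsto n S L \<Longrightarrow> mat_tendsto n S' L' \<Longrightarrow> mat_tendsto n (\<lambda>k. S k + S' k) (L + L')"
  by (rule mat_tendstoI) (auto simp: mat_tendstoD intro!: tendsto_add)

lemma mat_tendsto_minus:
  "mat_tendsto n S L \<Longrightarrow> mat_tendsto n S' L' \<Longrightarrow> mat_tendsto n (\<lambda>k. S k - S' k) (L - L')"
  by (rule mat_tendstoI) (auto simp: mat_tendstoD intro!: tendsto_diff)

lemma mat_tendsto_mult:
  "mat_tendsto n S L \<Longrightarrow> mat_tendsto n S' L' \<Longrightarrow> mat_tendsto n (\<lambda>k. S k * S' k) (L * L')"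
  by (rule mat_tendstoI)
    (auto simp: mat_tendstoD index_mult_sum intro!: tendsto_sum tendsto_mult simp del: index_mult_mat(1))

lemma mat_tendsto_adjoint:
  "mat_tendsto n S L \<Longrightarrow> mat_tendsto n (\<lambda>k. mat_adjoint (S k)) (mat_adjoint L)"
  by (rule mat_tendstoI) (auto simp: mat_tendstoD intro!: tendsto_cnj)

lemma mat_tendsto_Suc: "mat_tendsto n S L \<Longrightarrow> mat_tendsto n (\<lambda>k. S (Suc k)) L"
  by (rule mat_tendstoI) (auto simp: mat_tendstoD intro!: LIMSEQ_Suc)

lemma mat_tendsto_unique:
  assumes L: "mat_tendsto n S L" and L': "mat_tendsto n S L'"
  shows "L = L'"
proof (rule eq_matI)
  fix i j assume "i < dim_row L'" "j < dim_col L'"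
  hence ij: "i < n" "j < n" by (simp_all add: mat_tendstoD[OF L'])
  thus "L $$ (i, j) = L' $$ (i, j)" by (intro LIMSEQ_unique[OF mat_tendstoD(5)[OF L ij] mat_tendstoD(5)[OF L' ij]])
qed (simp_all add: mat_tendstoD[OF L] mat_tendstoD[OF L'])

lemma psd_limit:
  assumes S: "mat_tendsto n S L" and psd: "\<And>k. psd n (S k)"
  shows "psd n L"
proof (rule psdI)
  show "dim_row L = n" "dim_col L = n" using S by (auto simp: mat_tendstoD)
  have "mat_tendsto n S (mat_adjoint L)"
    using mat_tendsto_adjoint[OF S] psd_adjoint[OF psd] by simp
  thus "mat_adjoint L = L" using mat_tendsto_unique S by blast
next
  fix x :: "complex vec" assume x: "dim_vec x = n"
  have "(\<lambda>k. Re ((S k *\<^sub>v x) \<bullet>c x)) \<longlonglongrightarrow> Re ((L *\<^sub>v x) \<bullet>c x)"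
    using S x
    unfolding form_sum[OF carrier_matI[OF mat_tendstoD(3,4)[OF S]] x]
      form_sum[OF carrier_matI[OF mat_tendstoD(1,2)[OF S]] x]
    by (intro tendsto_Re tendsto_sum tendsto_mult tendsto_const) (auto intro: mat_tendstoD(5))
  thus "0 \<le> Re ((L *\<^sub>v x) \<bullet>c x)"
    by (rule LIMSEQ_le_const) (use psd_form[OF psd x] in auto)
qed

text \<open>The traces form a bounded increasing real sequence, hence a Cauchy sequence. Each
  \<open>S l - S k\<close> with \<open>k \<le> l\<close> is semidefinite, so
  \<open>psd_entry_le\<close> bounds its entries by the difference of the traces, and every entry is
  Cauchy as well.\<close>

lemma psd_incseq_convergent:
  assumes S: "\<And>k. S k \<in> carrier_mat n n" and P: "P \<in> carrier_mat n n"
    and step: "\<And>k. psd n (S (Suc k) - S k)" and bound: "\<And>k. psd n (P - S k)"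
  obtains L where "mat_tendsto n S L"
proof -
  define t where "t k = Re (tr (S k))" for k
  have dims [simp]: "dim_row (S k) = n" "dim_col (S k) = n" "dim_row P = n" "dim_col P = n" for k
    using S[of k] P by auto
  have diff: "t l - t k = Re (tr (S l - S k))" for k l
    by (simp add: t_def tr_linear)
  have "incseq t"
    using psd_tr_nonneg[OF step] diff by (intro incseq_SucI) (metis diff_ge_0_iff_ge)
  moreover have "t k \<le> Re (tr P)" for k
    using psd_tr_nonneg[OF bound, of k] by (simp add: t_def tr_linear)
  ultimately have "convergent t"
    by (meson incseq_convergent convergentI)
  hence "Cauchy t" by (rule convergent_Cauchy)
  have entry: "cmod (S l $$ (i, j) - S k $$ (i, j)) \<le> t l - t k" if "k \<le> l" "i < n" "j < n" for k l i j
    using psd_entry_le[OF psd_telescope[of S n, OF S step that(1)] that(2,3)] diff that by simp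
  have conv: "convergent (\<lambda>k. S k $$ (i, j))" if ij: "i < n" "j < n" for i j
  proof -
    have "Cauchy (\<lambda>k. S k $$ (i, j))"
    proof (rule CauchyI')
      fix e :: real assume "e > 0"
      then obtain N where N: "\<And>m k. m \<ge> N \<Longrightarrow> k \<ge> N \<Longrightarrow> norm (t m - t k) < e"
        using CauchyD[OF \<open>Cauchy t\<close>] by blast
      show "\<exists>M. \<forall>m\<ge>M. \<forall>k>m. dist (S m $$ (i, j)) (S k $$ (i, j)) < e"
      proof (intro exI allI impI)
        fix m k assume "N \<le> m" "m < k"
        hence "cmod (S k $$ (i, j) - S m $$ (i, j)) < e"
          using entry[of m k i j] N[of k m] ij by auto
        thus "dist (S m $$ (i, j)) (S k $$ (i, j)) < e"
          by (simp add: dist_norm norm_minus_commute)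
      qed
    qed
    thus ?thesis by (rule Cauchy_convergent)
  qed
  have "mat_tendsto n S (mat n n (\<lambda>(i, j). lim (\<lambda>k. S k $$ (i, j))))"
    using conv by (intro mat_tendstoI) (auto simp: convergent_LIMSEQ_iff)
  thus thesis by (rule that)
qed

lemma psd_decseq_convergent:
  assumes psd: "\<And>k. psd n (S k)" and step: "\<And>k. psd n (S k - S (Suc k))"
  obtains L where "mat_tendsto n S L"
proof -
  have [simp]: "dim_row (S k) = n" "dim_col (S k) = n" for k using psd_dim[OF psd[of k]] by auto
  obtain L where L: "mat_tendsto n (\<lambda>k. S 0 - S k) L"
  proof (rule psd_incseq_convergent)
    fix k
    have "(S 0 - S (Suc k)) - (S 0 - S k) = S k - S (Suc k)" by (rule eq_matI) auto
    thus "psd n ((S 0 - S (Suc k)) - (S 0 - S k))" using step by simp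
    have "S 0 - (S 0 - S k) = S k" by (rule eq_matI) auto
    thus "psd n (S 0 - (S 0 - S k))" using psd by simp
  qed (auto intro!: carrier_matI)
  have "mat_tendsto n (\<lambda>k. S 0 - (S 0 - S k)) (S 0 - L)"
    by (intro mat_tendsto_minus mat_tendsto_const L) (auto intro!: carrier_matI)
  moreover have "S 0 - (S 0 - S k) = S k" for k by (rule eq_matI) auto
  ultimately show thesis using that by simp
qed

text \<open>The Cayley transform \<open>C = (A + 1)(A - 1)\<^sup>-\<^sup>1 = 1 + 2 M\<close> turns the Lyapunov equation into
  the fixed point equation \<open>X = \<Phi> X\<close> of the monotone map \<open>\<Phi>\<close>, which is iterated from \<open>0\<close>
  below the supersolution \<open>P\<close>.\<close>

lemma lyapunov_solution_below:
  assumes A: "A \<in> carrier_mat n n" and M: "M \<in> carrier_mat n n"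
    and inv: "(A - 1\<^sub>m n) * M = 1\<^sub>m n" "M * (A - 1\<^sub>m n) = 1\<^sub>m n"
    and P: "psd n P" and Q: "psd n Q"
    and super: "psd n (- (mat_adjoint A * P + P * A) - Q)"
  obtains X where "psd n X" "psd n (P - X)" "mat_adjoint A * X + X * A + Q = 0\<^sub>m n n"
proof -
  define N where "N = A - 1\<^sub>m n"
  define C where "C = 1\<^sub>m n + M + M"
  define Q' where "Q' = mat_adjoint M * Q * M + mat_adjoint M * Q * M"
  define \<Phi> where "\<Phi> S = Q' + mat_adjoint C * S * C" for S
  \<comment> \<open>\<open>W S\<close> is the Lyapunov residual of \<open>S\<close> conjugated by
    \<open>M\<close>, and \<Phi> adds twice this residual to \<open>S\<close>. As \<open>M\<close>
    is invertible, the fixed points of \<Phi> are exactly the solutions.\<close>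
  define W where "W S = mat_adjoint M * (mat_adjoint A * S + S * A + Q) * M" for S
  have dA [simp]: "dim_row A = n" "dim_col A = n" "dim_row M = n" "dim_col M = n"
    "dim_row P = n" "dim_col P = n" "dim_row Q = n" "dim_col Q = n"
    using A M psd_dim[OF P] psd_dim[OF Q] by auto
  have A_eq: "A = N + 1\<^sub>m n" by (rule eq_matI) (auto simp: N_def)
  have dN [simp]: "dim_row N = n" "dim_col N = n" by (auto simp: N_def)
  have NM: "N * M = 1\<^sub>m n" "M * N = 1\<^sub>m n" using inv by (auto simp: N_def)
  have adj: "mat_adjoint M * mat_adjoint N = 1\<^sub>m n" "mat_adjoint N * mat_adjoint M = 1\<^sub>m n"
    using arg_cong[OF NM(1), of mat_adjoint] arg_cong[OF NM(2), of mat_adjoint]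
    by (simp_all add: adjoint_mult)
  have cancel: "mat_adjoint M * (mat_adjoint N * Z) = Z" "mat_adjoint N * (mat_adjoint M * Z) = Z"
    if "dim_row Z = n" for Z
    using that adj by (simp_all add: mult_assoc_dim[symmetric])
  have dC [simp]: "dim_row C = n" "dim_col C = n" by (auto simp: C_def)
  have dQ' [simp]: "dim_row Q' = n" "dim_col Q' = n" by (auto simp: Q'_def)
  have \<Phi>_W: "\<Phi> S = S + (W S + W S)" if [simp]: "dim_row S = n" "dim_col S = n" for S
    by (rule eq_matI)
      (simp_all add: \<Phi>_def W_def Q'_def C_def A_eq mat_expand NM cancel algebra_simps del: index_mult_mat(1))
  have Q'_psd: "psd n Q'"
    unfolding Q'_def by (intro psd_add psd_congruence[OF Q M])
  have dPhi [simp]: "dim_row (\<Phi> S) = n" "dim_col (\<Phi> S) = n" for S by (auto simp: \<Phi>_def)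
  have mono: "psd n (\<Phi> T - \<Phi> S)"
    if "psd n (T - S)" and [simp]: "dim_row S = n" "dim_col S = n" "dim_row T = n" "dim_col T = n" for S T
  proof -
    have "\<Phi> T - \<Phi> S = mat_adjoint C * (T - S) * C"
      by (rule eq_matI) (simp_all add: \<Phi>_def mat_expand algebra_simps del: index_mult_mat(1))
    thus ?thesis using psd_congruence[OF that(1) carrier_matI[OF dC]] by simp
  qed
  have P_super: "psd n (P - \<Phi> P)"
  proof -
    have "P - \<Phi> P = mat_adjoint M * (- (mat_adjoint A * P + P * A) - Q) * M
        + mat_adjoint M * (- (mat_adjoint A * P + P * A) - Q) * M"
      unfolding \<Phi>_W[of P, simplified] W_def
      by (rule eq_matI) (simp_all add: mat_expand algebra_simps del: index_mult_mat(1))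
    thus ?thesis using psd_add[OF psd_congruence[OF super M] psd_congruence[OF super M]] by simp
  qed
  define S where "S = rec_nat (0\<^sub>m n n) (\<lambda>_. \<Phi>)"
  have S0: "S 0 = 0\<^sub>m n n" and S_Suc: "S (Suc k) = \<Phi> (S k)" for k by (auto simp: S_def)
  have dS [simp]: "dim_row (S k) = n" "dim_col (S k) = n" for k
    by (cases k; simp add: S0 S_Suc)+
  have S1: "S (Suc 0) - S 0 = Q'"
    unfolding S_Suc S0 \<Phi>_def
    by (rule eq_matI) (simp_all add: mat_expand del: index_mult_mat(1))
  have step: "psd n (S (Suc k) - S k)" for k
  proof (induction k)
    case 0
    show ?case using S1 Q'_psd by simp
  next
    case (Suc k)
    show ?case unfolding S_Suc[of "Suc k"] using mono[OF Suc.IH] by (simp add: S_Suc)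
  qed
  have below: "psd n (P - S k)" for k
  proof (induction k)
    case 0
    have "P - S 0 = P" by (rule eq_matI) (auto simp: S0)
    thus ?case using P by simp
  next
    case (Suc k)
    have "psd n (P - \<Phi> (S k))"
      by (rule psd_le_trans[OF mono[OF Suc.IH] P_super]) (auto intro!: carrier_matI)
    thus ?case by (simp add: S_Suc)
  qed
  obtain X where X: "mat_tendsto n S X"
    by (rule psd_incseq_convergent[of S n P]) (auto intro!: carrier_matI step below)
  have [simp]: "dim_row X = n" "dim_col X = n" using X by (auto simp: mat_tendstoD)
  have "mat_tendsto n (\<lambda>k. \<Phi> (S k)) (\<Phi> X)"
    unfolding \<Phi>_def
    by (intro mat_tendsto_add mat_tendsto_mult mat_tendsto_const X) (auto intro!: carrier_matI)
  moreover have "mat_tendsto n (\<lambda>k. \<Phi> (S k)) X"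
    using mat_tendsto_Suc[OF X] by (simp add: S_Suc)
  ultimately have "\<Phi> X = X" by (rule mat_tendsto_unique)
  hence eq: "X + (W X + W X) = X" using \<Phi>_W[of X] by simp
  have W0: "W X = 0\<^sub>m n n"
  proof (rule eq_matI)
    fix i j assume "i < dim_row (0\<^sub>m n n :: complex mat)" "j < dim_col (0\<^sub>m n n :: complex mat)"
    thus "W X $$ (i, j) = 0\<^sub>m n n $$ (i, j)"
      using arg_cong[OF eq, of "\<lambda>Z. Z $$ (i, j)"] by (simp add: W_def del: index_mult_mat(1))
  qed (simp_all add: W_def)
  have "mat_adjoint A * X + X * A + Q = mat_adjoint N * W X * N"
    unfolding W_def by (simp add: mult_assoc_dim cancel NM)
  hence "mat_adjoint A * X + X * A + Q = 0\<^sub>m n n"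
    unfolding W0 by simp
  moreover have "psd n X"
  proof (rule psd_limit[OF X])
    fix k show "psd n (S k)"
    proof (cases k)
      case 0 thus ?thesis using psd_zero by (simp add: S0)
    next
      case (Suc l)
      have "psd n (S k - S 0)" by (rule psd_telescope[of S n, OF _ step]) (auto intro!: carrier_matI)
      moreover have "S k - S 0 = S k" by (rule eq_matI) (auto simp: S0)
      ultimately show ?thesis by simp
    qed
  qed
  moreover have "psd n (P - X)"
    by (rule psd_limit[OF mat_tendsto_minus[OF mat_tendsto_const X] below]) (auto intro!: carrier_matI)
  ultimately show thesis using that by blast
qed

section \<open>The Riccati equation\<close>

lemma eigenvalueE:
  assumes "eigenvalue A \<nu>" "A \<in> carrier_mat n n"
  obtains x where "dim_vec x = n" "x \<noteq> 0\<^sub>v n" "A *\<^sub>v x = \<nu> \<cdot>\<^sub>v x"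
  using assms unfolding eigenvalue_def eigenvector_def by (metis carrier_matD(1) carrier_vecD)

lemma eigenvalueI:
  assumes "A \<in> carrier_mat n n" "dim_vec x = n" "x \<noteq> 0\<^sub>v n" "A *\<^sub>v x = \<nu> \<cdot>\<^sub>v x"
  shows "eigenvalue A \<nu>"
  unfolding eigenvalue_def eigenvector_def
  by (rule exI[of _ x]) (use assms in \<open>auto intro!: carrier_vecI\<close>)

lemma Re_cscalar_self_pos:
  fixes x :: "complex vec"
  assumes "dim_vec x = n" "x \<noteq> 0\<^sub>v n"
  shows "0 < Re (x \<bullet>c x)"
  using conjugate_square_greater_0_vec[OF carrier_vecI[OF assms(1)]] assms(2)
  by (simp add: less_complex_def)

lemma inverse_if_not_eigenvalue:
  fixes A :: "complex mat"
  assumes A: "A \<in> carrier_mat n n" and "\<not> eigenvalue A \<mu>"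
  obtains M where "M \<in> carrier_mat n n"
    "(A - \<mu> \<cdot>\<^sub>m 1\<^sub>m n) * M = 1\<^sub>m n" "M * (A - \<mu> \<cdot>\<^sub>m 1\<^sub>m n) = 1\<^sub>m n"
proof -
  have eq: "char_matrix A \<mu> = A - \<mu> \<cdot>\<^sub>m 1\<^sub>m n"
    using A by (intro eq_matI) (auto simp: char_matrix_def)
  have "det (char_matrix A \<mu>) \<noteq> 0" using assms eigenvalue_det[OF A] by simp
  hence "char_matrix A \<mu> \<in> Units (ring_mat TYPE(complex) n ())"
    using A by (intro det_non_zero_imp_unit) auto
  thus thesis
    using that unfolding Units_def ring_mat_simps eq by auto
qed

text \<open>Otherwise \<open>A - cnj \<mu>\<close> has an inverse, whose adjoint is a left inverse
  of \<open>A\<^sup>* - \<mu>\<close>; applied to an eigenvector, it forces that vector to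
  vanish.\<close>

lemma eigenvalue_adjoint:
  assumes A: "A \<in> carrier_mat n n" and ev: "eigenvalue (mat_adjoint A) \<mu>"
  shows "eigenvalue A (cnj \<mu>)"
proof (rule ccontr)
  have dA [simp]: "dim_row A = n" "dim_col A = n" using A by auto
  assume "\<not> ?thesis"
  then obtain M where M: "M \<in> carrier_mat n n" and inv: "(A - cnj \<mu> \<cdot>\<^sub>m 1\<^sub>m n) * M = 1\<^sub>m n"
    using inverse_if_not_eigenvalue[OF A] by metis
  have dM [simp]: "dim_row M = n" "dim_col M = n" using M by auto
  obtain x where x [simp]: "dim_vec x = n" and "x \<noteq> 0\<^sub>v n" and eq: "mat_adjoint A *\<^sub>v x = \<mu> \<cdot>\<^sub>v x"
    using eigenvalueE[OF ev, of n] A by auto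
  have one: "1\<^sub>m n *\<^sub>v x = x" by (intro one_mult_mat_vec carrier_vecI[OF x])
  have "mat_adjoint M * (mat_adjoint A - \<mu> \<cdot>\<^sub>m 1\<^sub>m n) = 1\<^sub>m n"
    using arg_cong[OF inv, of mat_adjoint] by (simp add: adjoint_mult adjoint_minus adjoint_smult)
  hence "x = (mat_adjoint M * (mat_adjoint A - \<mu> \<cdot>\<^sub>m 1\<^sub>m n)) *\<^sub>v x"
    using one by simp
  also have "\<dots> = mat_adjoint M *\<^sub>v (mat_adjoint A *\<^sub>v x - \<mu> \<cdot>\<^sub>v x)"
    by (simp add: vec_expand one)
  also have "\<dots> = mat_adjoint M *\<^sub>v 0\<^sub>v n"
    unfolding eq by (rule arg_cong[of _ _ "\<lambda>v. _ *\<^sub>v v"]) (rule eq_vecI, auto)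
  also have "\<dots> = 0\<^sub>v n"
    by (rule eq_vecI) (auto simp: index_mult_vec_sum simp del: index_mult_mat_vec)
  finally show False using \<open>x \<noteq> 0\<^sub>v n\<close> by simp
qed

text \<open>On an eigenvector \<open>x\<close>, with \<open>p\<close> the value of the form of
  \<open>P\<close>, the hypothesis reads \<open>2 * Re \<nu> * p \<le> - (x \<bullet>c x)\<close>.
  The right side is negative and \<open>p \<ge> 0\<close>, so \<open>Re \<nu> < 0\<close>.\<close>

lemma lyapunov_stable:
  assumes A: "A \<in> carrier_mat n n" and P: "psd n P"
    and lyap: "psd n (- (mat_adjoint A * P + P * A) - 1\<^sub>m n)"
  shows "stable A"
  unfolding stable_def
proof (intro allI impI)
  fix \<nu> assume "eigenvalue A \<nu>"
  then obtain x where x [simp]: "dim_vec x = n" and x0: "x \<noteq> 0\<^sub>v n" and eq: "A *\<^sub>v x = \<nu> \<cdot>\<^sub>v x"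
    using eigenvalueE A by metis
  have [simp]: "dim_row A = n" "dim_col A = n" "dim_row P = n" "dim_col P = n"
    using A psd_dim[OF P] by auto
  have one: "1\<^sub>m n *\<^sub>v x = x" by (intro one_mult_mat_vec carrier_vecI[OF x])
  define p where "p = (P *\<^sub>v x) \<bullet>c x"
  have "((- (mat_adjoint A * P + P * A) - 1\<^sub>m n) *\<^sub>v x) \<bullet>c x = - (cnj \<nu> * p + \<nu> * p) - x \<bullet>c x"
    by (simp add: vec_expand cscalar_linear adjoint_cscalar one eq p_def)
  hence "0 \<le> Re (- (cnj \<nu> * p + \<nu> * p) - x \<bullet>c x)"
    using psd_form[OF lyap x] by simp
  hence "2 * (Re \<nu> * Re p) < 0"
    using Re_cscalar_self_pos[OF x x0] by simp
  moreover have "0 \<le> Re p" unfolding p_def by (rule psd_form[OF P x])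
  ultimately show "Re \<nu> < 0" by (smt (verit) mult_nonneg_nonneg)
qed

section \<open>Newton-Kleinman iteration for the Riccati equation\<close>

lemma smult_one_mat: "1 \<cdot>\<^sub>m A = (A :: complex mat)"
  by (rule eq_matI) auto

text \<open>\<open>Y\<close> solves the Riccati equation linearised at \<open>X\<close>, which is
  the Lyapunov equation of the closed loop \<open>A - G * X\<close>. The Riccati map is quadratic,
  so its value at \<open>Y\<close> is exactly the second order term
  \<open>(X - Y) * G * (X - Y)\<close>, and \<open>Y\<close> is a supersolution again.\<close>

lemma newton_step:
  assumes A: "A \<in> carrier_mat n n" and G: "psd n G" and X: "psd n X"
    and super: "psd n (X * G * X - (mat_adjoint A * X + X * A) - 1\<^sub>m n)"
  obtains Y where "psd n Y" "psd n (X - Y)"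
    "psd n (Y * G * Y - (mat_adjoint A * Y + Y * A) - 1\<^sub>m n)"
    "mat_adjoint (A - G * X) * Y + Y * (A - G * X) + (1\<^sub>m n + X * G * X) = 0\<^sub>m n n"
proof -
  define F where "F = A - G * X"
  define Q where "Q = 1\<^sub>m n + X * G * X"
  have [simp]: "dim_row A = n" "dim_col A = n" "dim_row G = n" "dim_col G = n"
    "dim_row X = n" "dim_col X = n" and [simp]: "mat_adjoint G = G" "mat_adjoint X = X"
    using A psd_dim[OF G] psd_dim[OF X] psd_adjoint[OF G] psd_adjoint[OF X] by auto
  have F: "F \<in> carrier_mat n n" by (auto simp: F_def intro!: carrier_matI)
  have XGX: "psd n (X * G * X)" using psd_congruence[OF G psd_carrier[OF X]] by simp
  have Q: "psd n Q" unfolding Q_def by (rule psd_add[OF psd_one XGX])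
  \<comment> \<open>The residual of \<open>X\<close> in the linearised equation equals its Riccati
    residual, so \<open>X\<close> is a bound under which the Lyapunov iteration can run.\<close>
  have super': "psd n (- (mat_adjoint F * X + X * F) - Q)"
  proof -
    have "- (mat_adjoint F * X + X * F) - Q = X * G * X - (mat_adjoint A * X + X * A) - 1\<^sub>m n"
      by (rule eq_matI) (simp_all add: F_def Q_def mat_expand algebra_simps del: index_mult_mat(1))
    thus ?thesis using super by simp
  qed
  have "psd n (- (mat_adjoint F * X + X * F) - 1\<^sub>m n)"
  proof -
    have "- (mat_adjoint F * X + X * F) - 1\<^sub>m n = (- (mat_adjoint F * X + X * F) - Q) + X * G * X"
      by (rule eq_matI) (simp_all add: F_def Q_def mat_expand algebra_simps del: index_mult_mat(1))
    thus ?thesis using psd_add[OF super' XGX] by simp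
  qed
  \<comment> \<open>Stability excludes the eigenvalue 1, which makes the inverse in the Cayley
    transform available.\<close>
  hence "stable F" by (rule lyapunov_stable[OF F X])
  hence "\<not> eigenvalue F 1" by (auto simp: stable_def)
  then obtain M where M: "M \<in> carrier_mat n n" "(F - 1\<^sub>m n) * M = 1\<^sub>m n" "M * (F - 1\<^sub>m n) = 1\<^sub>m n"
    using inverse_if_not_eigenvalue[OF F, of 1] by (metis smult_one_mat)
  obtain Y where Y: "psd n Y" "psd n (X - Y)" and eq: "mat_adjoint F * Y + Y * F + Q = 0\<^sub>m n n"
    using lyapunov_solution_below[OF F M X Q super'] by metis
  have [simp]: "dim_row Y = n" "dim_col Y = n" and [simp]: "mat_adjoint Y = Y"
    using psd_dim[OF Y(1)] psd_adjoint[OF Y(1)] by auto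
  have "Y * G * Y - (mat_adjoint A * Y + Y * A) - 1\<^sub>m n = mat_adjoint (X - Y) * G * (X - Y)"
  proof (rule eq_matI)
    fix i j assume "i < dim_row (mat_adjoint (X - Y) * G * (X - Y))" "j < dim_col (mat_adjoint (X - Y) * G * (X - Y))"
    hence ij: "i < n" "j < n" by auto
    show "(Y * G * Y - (mat_adjoint A * Y + Y * A) - 1\<^sub>m n) $$ (i, j)
        = (mat_adjoint (X - Y) * G * (X - Y)) $$ (i, j)"
      using arg_cong[OF eq, of "\<lambda>Z. Z $$ (i, j)"] ij
      by (simp add: F_def Q_def mat_expand algebra_simps del: index_mult_mat(1))
  qed auto
  moreover have "psd n (mat_adjoint (X - Y) * G * (X - Y))"
    by (rule psd_congruence[OF G psd_carrier[OF Y(2)]])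
  ultimately show thesis using that Y eq by (simp add: F_def Q_def)
qed

text \<open>The Newton iterates decrease and stay semidefinite, hence converge. In the limit
  \<open>S k\<close> and \<open>S (Suc k)\<close> merge, and the linearised equation becomes the
  Riccati equation itself.\<close>

lemma riccati_exists_below:
  assumes A: "A \<in> carrier_mat n n" and G: "psd n G" and P: "psd n P"
    and super: "psd n (P * G * P - (mat_adjoint A * P + P * A) - 1\<^sub>m n)"
  obtains X where "psd n X" "X * G * X - X * A - mat_adjoint A * X - 1\<^sub>m n = 0\<^sub>m n n"
proof -
  define good where "good X \<longleftrightarrow> psd n X \<and> psd n (X * G * X - (mat_adjoint A * X + X * A) - 1\<^sub>m n)" for X
  define next_rel where "next_rel X Y \<longleftrightarrow> psd n (X - Y) \<and>
    mat_adjoint (A - G * X) * Y + Y * (A - G * X) + (1\<^sub>m n + X * G * X) = 0\<^sub>m n n" for X Y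
  have "\<exists>S. \<forall>k. good (S k) \<and> next_rel (S k) (S (Suc k))"
  proof (rule dependent_nat_choice)
    show "\<exists>X. good X" using P super by (auto simp: good_def)
    fix X assume "good X"
    thus "\<exists>Y. good Y \<and> next_rel X Y"
      unfolding good_def next_rel_def using newton_step[OF A G, of X] by metis
  qed
  then obtain S where psd: "\<And>k. psd n (S k)" and dec: "\<And>k. psd n (S k - S (Suc k))"
    and eq: "\<And>k. mat_adjoint (A - G * S k) * S (Suc k) + S (Suc k) * (A - G * S k)
      + (1\<^sub>m n + S k * G * S k) = 0\<^sub>m n n"
    unfolding good_def next_rel_def by blast
  obtain X where X: "mat_tendsto n S X"
    using psd_decseq_convergent[of n S] psd dec by metis
  have psdX: "psd n X" using psd_limit[OF X psd] .
  have [simp]: "dim_row A = n" "dim_col A = n" "dim_row G = n" "dim_col G = n"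
    "dim_row X = n" "dim_col X = n" and [simp]: "mat_adjoint G = G" "mat_adjoint X = X"
    using A psd_dim[OF G] psd_dim[OF psdX] psd_adjoint[OF G] psd_adjoint[OF psdX] by auto
  have "mat_tendsto n (\<lambda>k. mat_adjoint (A - G * S k) * S (Suc k) + S (Suc k) * (A - G * S k)
      + (1\<^sub>m n + S k * G * S k)) (mat_adjoint (A - G * X) * X + X * (A - G * X) + (1\<^sub>m n + X * G * X))"
    by (intro mat_tendsto_add mat_tendsto_mult mat_tendsto_minus mat_tendsto_adjoint
        mat_tendsto_const X mat_tendsto_Suc[OF X] A psd_carrier[OF G] one_carrier_mat)
  hence "mat_tendsto n (\<lambda>k. 0\<^sub>m n n) (mat_adjoint (A - G * X) * X + X * (A - G * X) + (1\<^sub>m n + X * G * X))"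
    unfolding eq .
  hence lim: "mat_adjoint (A - G * X) * X + X * (A - G * X) + (1\<^sub>m n + X * G * X) = 0\<^sub>m n n"
    by (rule mat_tendsto_unique) (rule mat_tendsto_const, simp)
  have "X * G * X - X * A - mat_adjoint A * X - 1\<^sub>m n = 0\<^sub>m n n"
  proof (rule eq_matI)
    fix i j assume "i < dim_row (0\<^sub>m n n :: complex mat)" "j < dim_col (0\<^sub>m n n :: complex mat)"
    hence ij: "i < n" "j < n" by auto
    show "(X * G * X - X * A - mat_adjoint A * X - 1\<^sub>m n) $$ (i, j) = 0\<^sub>m n n $$ (i, j)"
      using arg_cong[OF lim, of "\<lambda>Z. Z $$ (i, j)"] ij
      by (simp add: mat_expand algebra_simps del: index_mult_mat(1))
  qed auto
  thus thesis using that psdX by blast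
qed

section \<open>Schur form, Sylvester equation and uniqueness\<close>

lemma schur_complex:
  fixes A :: "complex mat"
  assumes A: "A \<in> carrier_mat n n"
  obtains T P Q where "T \<in> carrier_mat n n" "P \<in> carrier_mat n n" "Q \<in> carrier_mat n n"
    "P * Q = 1\<^sub>m n" "Q * P = 1\<^sub>m n" "A = P * T * Q" "upper_triangular T"
    "\<And>i. i < n \<Longrightarrow> eigenvalue A (T $$ (i, i))"
proof -
  obtain es where es: "char_poly A = (\<Prod>a\<leftarrow>es. [:- a, 1:])"
    using char_poly_factorized[OF A] by auto
  obtain T P Q where "schur_decomposition A es = (T, P, Q)" by (metis prod_cases3)
  from schur_decomposition[OF A es this]
  have sim: "similar_mat_wit A T P Q" and ut: "upper_triangular T" and diag: "diag_mat T = es" by auto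
  note w = similar_mat_witD2[OF A sim]
  have "eigenvalue A (T $$ (i, i))" if "i < n" for i
  proof -
    have "T $$ (i, i) \<in> set es" using that w(5) by (auto simp: diag[symmetric] diag_mat_def)
    thus ?thesis
      unfolding eigenvalue_root_char_poly[OF A] es by (simp add: poly_prod_list prod_list_zero_iff image_iff)
  qed
  thus thesis using that w ut by blast
qed

text \<open>In a Schur basis \<open>A\<close> becomes an upper triangular \<open>T\<close>. Once the
  earlier columns of \<open>W\<close> vanish, column \<open>j\<close> is mapped by \<open>F\<close>
  to \<open>T $$ (j, j)\<close> times itself; this number is an eigenvalue of \<open>A\<close>,
  hence not of \<open>F\<close>, and the column is zero.\<close>

lemma sylvester_unique:
  fixes A F Z :: "complex mat"
  assumes A: "A \<in> carrier_mat n n" and F: "F \<in> carrier_mat n n" and Z: "Z \<in> carrier_mat n n"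
    and disj: "\<And>\<nu>. eigenvalue A \<nu> \<Longrightarrow> \<not> eigenvalue F \<nu>"
    and eq: "Z * A = F * Z"
  shows "Z = 0\<^sub>m n n"
proof -
  obtain T P Q where T: "T \<in> carrier_mat n n" and P: "P \<in> carrier_mat n n" and Q: "Q \<in> carrier_mat n n"
    and PQ: "P * Q = 1\<^sub>m n" "Q * P = 1\<^sub>m n" and A_eq: "A = P * T * Q"
    and ut: "upper_triangular T" and ev: "\<And>i. i < n \<Longrightarrow> eigenvalue A (T $$ (i, i))"
    by (rule schur_complex[OF A]) auto
  define W where "W = Z * P"
  have [simp]: "dim_row T = n" "dim_col T = n" "dim_row P = n" "dim_col P = n" "dim_row Q = n" "dim_col Q = n"
    "dim_row A = n" "dim_col A = n" "dim_row F = n" "dim_col F = n" "dim_row Z = n" "dim_col Z = n"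
    "dim_row W = n" "dim_col W = n"
    using A F Z T P Q by (auto simp: W_def)
  have WT: "W * T = F * W"
  proof -
    have "A * P = P * T" unfolding A_eq by (simp add: mult_assoc_dim PQ)
    hence "W * T = Z * A * P" unfolding W_def by (simp add: mult_assoc_dim)
    also have "\<dots> = F * W" unfolding eq W_def by (simp add: mult_assoc_dim)
    finally show ?thesis .
  qed
  have col: "\<forall>i<n. W $$ (i, j) = 0" if "j < n" for j
    using that
  proof (induction j rule: less_induct)
    case (less j)
    have "F *\<^sub>v col W j = T $$ (j, j) \<cdot>\<^sub>v col W j"
    proof (rule eq_vecI)
      fix i assume "i < dim_vec (T $$ (j, j) \<cdot>\<^sub>v col W j)"
      hence i: "i < n" by simp
      have "(F *\<^sub>v col W j) $ i = (F * W) $$ (i, j)" using i less.prems by simp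
      also have "\<dots> = (\<Sum>k<n. W $$ (i, k) * T $$ (k, j))"
        unfolding WT[symmetric] using i less.prems by (simp add: index_mult_sum del: index_mult_mat(1))
      also have "\<dots> = (\<Sum>k\<in>{j}. W $$ (i, k) * T $$ (k, j))"
      proof (rule sum.mono_neutral_right, safe)
        fix k assume k: "k < n" "W $$ (i, k) * T $$ (k, j) \<noteq> 0" "k \<notin> {}"
        show "k = j"
        proof (rule ccontr)
          assume "k \<noteq> j"
          hence "k < j \<or> j < k" by auto
          thus False using k less i upper_triangularD[OF ut, of j k] by auto
        qed
      qed (use less.prems in auto)
      finally show "(F *\<^sub>v col W j) $ i = (T $$ (j, j) \<cdot>\<^sub>v col W j) $ i"
        using i less.prems by simp
    qed simp
    hence "col W j = 0\<^sub>v n"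
      using eigenvalueI[OF F, of "col W j"] ev[OF less.prems] disj by fastforce
    thus ?case using less.prems by (metis index_col index_zero_vec(1) \<open>dim_row W = n\<close> \<open>dim_col W = n\<close>)
  qed
  have "W = 0\<^sub>m n n" using col by (intro eq_matI) auto
  moreover have "Z = W * Q" unfolding W_def by (simp add: mult_assoc_dim PQ)
  ultimately show ?thesis by simp
qed

text \<open>Rearranged, the Riccati equation is a Lyapunov equation of the closed loop with the term
  \<open>1 + X G X\<close>, and \<open>X\<close> itself is the Lyapunov matrix.\<close>

lemma riccati_closed_loop_stable:
  assumes A: "A \<in> carrier_mat n n" and G: "psd n G" and X: "psd n X"
    and eq: "X * G * X - X * A - mat_adjoint A * X - 1\<^sub>m n = 0\<^sub>m n n"
  shows "stable (A - G * X)"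
proof (rule lyapunov_stable[OF _ X])
  have [simp]: "dim_row A = n" "dim_col A = n" "dim_row G = n" "dim_col G = n"
    "dim_row X = n" "dim_col X = n" and [simp]: "mat_adjoint G = G" "mat_adjoint X = X"
    using A psd_dim[OF G] psd_dim[OF X] psd_adjoint[OF G] psd_adjoint[OF X] by auto
  show "A - G * X \<in> carrier_mat n n" by (auto intro!: carrier_matI)
  have "- (mat_adjoint (A - G * X) * X + X * (A - G * X)) - 1\<^sub>m n = mat_adjoint X * G * X"
  proof (rule eq_matI)
    fix i j assume "i < dim_row (mat_adjoint X * G * X)" "j < dim_col (mat_adjoint X * G * X)"
    hence ij: "i < n" "j < n" by auto
    show "(- (mat_adjoint (A - G * X) * X + X * (A - G * X)) - 1\<^sub>m n) $$ (i, j)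
        = (mat_adjoint X * G * X) $$ (i, j)"
      using arg_cong[OF eq, of "\<lambda>Z. Z $$ (i, j)"] ij
      by (simp add: mat_expand algebra_simps del: index_mult_mat(1))
  qed auto
  thus "psd n (- (mat_adjoint (A - G * X) * X + X * (A - G * X)) - 1\<^sub>m n)"
    using psd_congruence[OF G psd_carrier[OF X]] by simp
qed

text \<open>Pairing the two different closed loops absorbs the quadratic terms:
  \<open>(X - Y) (A - G Y) = - (A - G X)\<^sup>* (X - Y)\<close>. The eigenvalues of
  \<open>A - G Y\<close> lie in the left half plane and those of the other coefficient in the right
  one, so the difference vanishes.\<close>

lemma riccati_unique:
  assumes A: "A \<in> carrier_mat n n" and G: "psd n G" and X: "psd n X" and Y: "psd n Y"
    and eqX: "X * G * X - X * A - mat_adjoint A * X - 1\<^sub>m n = 0\<^sub>m n n"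
    and eqY: "Y * G * Y - Y * A - mat_adjoint A * Y - 1\<^sub>m n = 0\<^sub>m n n"
  shows "X = Y"
proof -
  have [simp]: "dim_row A = n" "dim_col A = n" "dim_row G = n" "dim_col G = n"
    "dim_row X = n" "dim_col X = n" "dim_row Y = n" "dim_col Y = n"
    and [simp]: "mat_adjoint G = G" "mat_adjoint X = X" "mat_adjoint Y = Y"
    using A psd_dim[OF G] psd_dim[OF X] psd_adjoint[OF G] psd_adjoint[OF X]
      psd_dim[OF Y] psd_adjoint[OF Y] by auto
  define F where "F = - mat_adjoint (A - G * X)"
  have F: "F \<in> carrier_mat n n" by (auto simp: F_def intro!: carrier_matI)
  have "X - Y = 0\<^sub>m n n"
  proof (rule sylvester_unique[OF _ F])
    show "A - G * Y \<in> carrier_mat n n" "X - Y \<in> carrier_mat n n" by (auto intro!: carrier_matI)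
    fix \<nu> assume "eigenvalue (A - G * Y) \<nu>"
    hence neg: "Re \<nu> < 0"
      using riccati_closed_loop_stable[OF A G Y eqY] by (simp add: stable_def)
    show "\<not> eigenvalue F \<nu>"
    proof
      assume "eigenvalue F \<nu>"
      then obtain x where x: "dim_vec x = n" "x \<noteq> 0\<^sub>v n" "F *\<^sub>v x = \<nu> \<cdot>\<^sub>v x"
        using eigenvalueE F by metis
      have "mat_adjoint (A - G * X) *\<^sub>v x = - (F *\<^sub>v x)"
        using x(1) by (simp add: F_def)
      also have "\<dots> = (- \<nu>) \<cdot>\<^sub>v x" unfolding x(3) by (rule eq_vecI) auto
      finally have "eigenvalue (mat_adjoint (A - G * X)) (- \<nu>)"
        using x by (intro eigenvalueI[of _ n x]) (auto intro!: carrier_matI)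
      hence "eigenvalue (A - G * X) (cnj (- \<nu>))"
        by (intro eigenvalue_adjoint[of _ n]) (auto intro!: carrier_matI)
      hence "Re (cnj (- \<nu>)) < 0"
        using riccati_closed_loop_stable[OF A G X eqX] unfolding stable_def by blast
      thus False using neg by simp
    qed
  next
    show "(X - Y) * (A - G * Y) = F * (X - Y)"
    proof (rule eq_matI)
      fix i j assume "i < dim_row (F * (X - Y))" "j < dim_col (F * (X - Y))"
      hence ij: "i < n" "j < n" by (auto simp: F_def)
      show "((X - Y) * (A - G * Y)) $$ (i, j) = (F * (X - Y)) $$ (i, j)"
        using arg_cong[OF eqX, of "\<lambda>Z. Z $$ (i, j)"] arg_cong[OF eqY, of "\<lambda>Z. Z $$ (i, j)"] ij
        by (simp add: F_def mat_expand algebra_simps del: index_mult_mat(1))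
    qed (auto simp: F_def)
  qed
  hence "(X - Y) $$ (i, j) = 0" if "i < n" "j < n" for i j using that by simp
  thus ?thesis by (intro eq_matI) auto
qed

section \<open>Diagonal dominance and supersolutions\<close>

text \<open>This turns bounds on entries into semidefiniteness: the inequality of arithmetic and
  geometric means bounds each off-diagonal term of the form by squares of components.\<close>

lemma diag_dominant_psd:
  assumes H: "H \<in> carrier_mat n n" "mat_adjoint H = H" and e: "0 \<le> e"
    and diag: "\<And>i. i < n \<Longrightarrow> real n * e \<le> Re (H $$ (i, i))"
    and off: "\<And>i j. i < n \<Longrightarrow> j < n \<Longrightarrow> i \<noteq> j \<Longrightarrow> cmod (H $$ (i, j)) \<le> e"
  shows "psd n H"
proof (rule psdI)
  fix x :: "complex vec" assume x: "dim_vec x = n"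
  define a where "a i = (cmod (x $ i))\<^sup>2" for i
  define s where "s = (\<Sum>i<n. a i)"
  \<comment> \<open>The term \<open>e * a i\<close> is subtracted for \<open>i = j\<close> as well,
    which keeps the second part uniform in both indices; the lower bounds then add up to exactly
    zero.\<close>
  have summand: "(if i = j then real n * e * a i else 0) - e * (a i + a j) / 2
      \<le> Re (H $$ (i, j) * x $ j * cnj (x $ i))" if "i < n" "j < n" for i j
  proof (cases "i = j")
    case True
    have re: "Re (H $$ (i, i) * x $ i * cnj (x $ i)) = Re (H $$ (i, i)) * a i"
      unfolding mult.assoc complex_norm_square[symmetric] by (simp add: a_def)
    have "real n * e * a i \<le> Re (H $$ (i, i)) * a i"
      using diag[OF that(1)] by (intro mult_right_mono) (auto simp: a_def)
    moreover have "0 \<le> e * a i" using e by (simp add: a_def)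
    ultimately show ?thesis unfolding True[symmetric] re by simp
  next
    case False
    have "cmod (H $$ (i, j) * x $ j * cnj (x $ i)) \<le> e * (cmod (x $ j) * cmod (x $ i))"
      unfolding norm_mult mult.assoc using off[OF that False] e by (intro mult_mono) auto
    also have "\<dots> \<le> e * ((a i + a j) / 2)"
      using sum_squares_bound[of "cmod (x $ i)" "cmod (x $ j)"] e
      by (intro mult_left_mono) (auto simp: a_def mult_ac)
    finally show ?thesis
      using False abs_Re_le_cmod[of "H $$ (i, j) * x $ j * cnj (x $ i)"] by simp
  qed
  have "(\<Sum>i<n. \<Sum>j<n. (if i = j then real n * e * a i else 0) - e * (a i + a j) / 2)
      = (\<Sum>i<n. real n * e * a i - e * (real n * a i + s) / 2)"
  proof (rule sum.cong[OF refl])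
    fix i assume "i \<in> {..<n}"
    hence "(\<Sum>j<n. if i = j then real n * e * a i else 0) = real n * e * a i" by simp
    moreover have "(\<Sum>j<n. e * (a i + a j) / 2) = e * (real n * a i + s) / 2"
      by (simp add: s_def sum.distrib sum_distrib_left sum_divide_distrib[symmetric] distrib_left)
    ultimately show "(\<Sum>j<n. (if i = j then real n * e * a i else 0) - e * (a i + a j) / 2)
        = real n * e * a i - e * (real n * a i + s) / 2"
      by (simp only: sum_subtractf)
  qed
  also have "\<dots> = real n * e * s - e * (real n * s + real n * s) / 2"
    by (simp add: s_def sum_subtractf sum.distrib sum_distrib_left[symmetric] sum_divide_distrib[symmetric] algebra_simps)
  also have "\<dots> = 0" by simp
  finally have "0 \<le> (\<Sum>i<n. \<Sum>j<n. Re (H $$ (i, j) * x $ j * cnj (x $ i)))"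
    using summand by (metis (no_types, lifting) lessThan_iff sum_mono)
  thus "0 \<le> Re ((H *\<^sub>v x) \<bullet>c x)"
    unfolding form_sum[OF H(1) x] by simp
qed (use H in auto)

lemma hermitian_le_scalar:
  assumes Z: "Z \<in> carrier_mat n n" "mat_adjoint Z = Z"
  obtains c where "0 < c" "psd n (complex_of_real c \<cdot>\<^sub>m 1\<^sub>m n - Z)"
proof -
  define e where "e = (\<Sum>i<n. \<Sum>j<n. cmod (Z $$ (i, j)))"
  \<comment> \<open>One \<open>e\<close> absorbs the diagonal entry of \<open>Z\<close>, the other
    \<open>n\<close> give dominance, and the summand 1 keeps \<open>c\<close> positive when
    \<open>Z\<close> is zero.\<close>
  define c where "c = 1 + (real n + 1) * e"
  have [simp]: "dim_row Z = n" "dim_col Z = n" using Z by auto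
  have e0: "0 \<le> e" by (auto simp: e_def intro!: sum_nonneg)
  have le: "cmod (Z $$ (i, j)) \<le> e" if "i < n" "j < n" for i j
  proof -
    have "cmod (Z $$ (i, j)) \<le> (\<Sum>j<n. cmod (Z $$ (i, j)))"
      using that by (intro member_le_sum) auto
    also have "\<dots> \<le> e"
      unfolding e_def using that by (intro member_le_sum[of i _ "\<lambda>i. \<Sum>j<n. cmod (Z $$ (i, j))"]) (auto intro!: sum_nonneg)
    finally show ?thesis .
  qed
  have "psd n (complex_of_real c \<cdot>\<^sub>m 1\<^sub>m n - Z)"
  proof (rule diag_dominant_psd[OF _ _ e0])
    show "complex_of_real c \<cdot>\<^sub>m 1\<^sub>m n - Z \<in> carrier_mat n n" by (auto intro!: carrier_matI)
    show "mat_adjoint (complex_of_real c \<cdot>\<^sub>m 1\<^sub>m n - Z) = complex_of_real c \<cdot>\<^sub>m 1\<^sub>m n - Z"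
      using Z(2) by (simp add: mat_expand)
  next
    fix i assume "i < n"
    thus "real n * e \<le> Re ((complex_of_real c \<cdot>\<^sub>m 1\<^sub>m n - Z) $$ (i, i))"
      using le[of i i] complex_Re_le_cmod[of "Z $$ (i, i)"] by (simp add: c_def algebra_simps)
  next
    fix i j assume "i < n" "j < n" "i \<noteq> j"
    thus "cmod ((complex_of_real c \<cdot>\<^sub>m 1\<^sub>m n - Z) $$ (i, j)) \<le> e"
      using le[of i j] by simp
  qed
  moreover have "0 < c" using e0 by (simp add: c_def add_pos_nonneg)
  ultimately show thesis using that by blast
qed

text \<open>Conjugating a triangular form of \<open>A\<close> by \<open>diag (1, \<eta>, \<eta>\<^sup>2, \<dots>)\<close> scales the entries above the
  diagonal by positive powers of \<open>\<eta>\<close>. For small \<open>\<eta>\<close> the result \<open>T'\<close> is dissipative.\<close>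

lemma stable_lyapunov_strict:
  assumes A: "A \<in> carrier_mat n n" and stable: "stable A"
  obtains P c where "psd n P" "0 < c" "psd n (- (mat_adjoint A * P + P * A) - complex_of_real c \<cdot>\<^sub>m 1\<^sub>m n)"
proof -
  obtain T R Q where T: "T \<in> carrier_mat n n" and R: "R \<in> carrier_mat n n" and Q: "Q \<in> carrier_mat n n"
    and RQ: "R * Q = 1\<^sub>m n" "Q * R = 1\<^sub>m n" and A_eq: "A = R * T * Q"
    and ut: "upper_triangular T" and ev: "\<And>i. i < n \<Longrightarrow> eigenvalue A (T $$ (i, i))"
    by (rule schur_complex[OF A]) auto
  have [simp]: "dim_row T = n" "dim_col T = n" "dim_row R = n" "dim_col R = n" "dim_row Q = n" "dim_col Q = n"
    "dim_row A = n" "dim_col A = n"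
    using A T R Q by auto
  \<comment> \<open>The element 1 keeps the set nonempty when \<open>n = 0\<close>.\<close>
  define a where "a = Min (insert 1 ((\<lambda>i. - Re (T $$ (i, i))) ` {..<n}))"
  have a0: "0 < a"
    unfolding a_def using ev stable by (subst Min_gr_iff) (auto simp: stable_def)
  have a_le: "a \<le> - Re (T $$ (i, i))" if "i < n" for i
    unfolding a_def using that by (intro Min_le) auto
  define L where "L = (\<Sum>i<n. \<Sum>j<n. cmod (T $$ (i, j)))"
  have L0: "0 \<le> L" by (auto simp: L_def intro!: sum_nonneg)
  have L_le: "cmod (T $$ (i, j)) \<le> L" if "i < n" "j < n" for i j
  proof -
    have "cmod (T $$ (i, j)) \<le> (\<Sum>j<n. cmod (T $$ (i, j)))"
      using that by (intro member_le_sum) auto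
    also have "\<dots> \<le> L"
      unfolding L_def using that by (intro member_le_sum[of i _ "\<lambda>i. \<Sum>j<n. cmod (T $$ (i, j))"]) (auto intro!: sum_nonneg)
    finally show ?thesis .
  qed
  \<comment> \<open>Chosen for \<open>n * (\<eta> * L) \<le> a\<close>, where \<open>a\<close> is a
    lower bound for the diagonal of \<open>H\<close> below. The 1 in the denominator covers
    \<open>L = 0\<close>; the minimum with 1 makes the powers of \<eta> decrease.\<close>
  define \<eta> where "\<eta> = min 1 (a / (real n * L + 1))"
  have \<eta>0: "0 < \<eta>" and \<eta>1: "\<eta> \<le> 1" using a0 L0 by (auto simp: \<eta>_def add_nonneg_pos)
  have nL: "0 < real n * L + 1" using L0 by (simp add: add_nonneg_pos)
  have "\<eta> * (real n * L + 1) \<le> a / (real n * L + 1) * (real n * L + 1)"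
    using nL by (intro mult_right_mono) (auto simp: \<eta>_def)
  also have "\<dots> = a" using nL by simp
  finally have small: "real n * (\<eta> * L) \<le> a" using \<eta>0 by (simp add: algebra_simps)
  define T' where "T' = mat n n (\<lambda>(i, j). T $$ (i, j) * complex_of_real (\<eta> ^ j / \<eta> ^ i))"
  define U where "U = mat n n (\<lambda>(i, j). Q $$ (i, j) / complex_of_real (\<eta> ^ i))"
  define V where "V = mat n n (\<lambda>(i, j). R $$ (i, j) * complex_of_real (\<eta> ^ j))"
  have [simp]: "dim_row T' = n" "dim_col T' = n" "dim_row U = n" "dim_col U = n" "dim_row V = n" "dim_col V = n"
    by (auto simp: T'_def U_def V_def)
  have VU: "V * U = 1\<^sub>m n"
    unfolding RQ(1)[symmetric]
    by (rule eq_matI) (use \<eta>0 in \<open>auto simp: index_mult_sum U_def V_def simp del: index_mult_mat(1)\<close>)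
  have "Q * A = T * Q" unfolding A_eq using RQ by (simp add: mult_assoc_dim[symmetric])
  have UA: "U * A = T' * U"
  proof (rule eq_matI)
    fix i j assume "i < dim_row (T' * U)" "j < dim_col (T' * U)"
    hence ij: "i < n" "j < n" by auto
    have "(U * A) $$ (i, j) = (Q * A) $$ (i, j) / complex_of_real (\<eta> ^ i)"
      using ij by (simp add: index_mult_sum U_def sum_divide_distrib del: index_mult_mat(1))
    also have "\<dots> = (T * Q) $$ (i, j) / complex_of_real (\<eta> ^ i)"
      unfolding \<open>Q * A = T * Q\<close> ..
    also have "\<dots> = (T' * U) $$ (i, j)"
      using ij \<eta>0 by (simp add: index_mult_sum U_def T'_def sum_divide_distrib field_simps del: index_mult_mat(1))
    finally show "(U * A) $$ (i, j) = (T' * U) $$ (i, j)" .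
  qed auto
  define H where "H = - (mat_adjoint T' + T') - complex_of_real a \<cdot>\<^sub>m 1\<^sub>m n"
  have T'_off: "cmod (T' $$ (i, j)) \<le> \<eta> * L" if "i < n" "j < n" "i \<noteq> j" for i j
  proof (cases "i < j")
    case True
    have "\<eta> ^ j / \<eta> ^ i = \<eta> ^ (j - i)" using \<eta>0 True by (simp add: power_diff)
    also have "\<dots> \<le> \<eta> ^ 1" using \<eta>0 \<eta>1 True by (intro power_decreasing) auto
    finally have "\<eta> ^ j / \<eta> ^ i \<le> \<eta>" by simp
    hence "cmod (T $$ (i, j)) * (\<eta> ^ j / \<eta> ^ i) \<le> L * \<eta>"
      using L_le[OF that(1,2)] L0 \<eta>0 by (intro mult_mono) auto
    thus ?thesis using that \<eta>0 by (simp add: T'_def norm_mult norm_divide norm_power mult.commute)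
  next
    case False
    hence "T' $$ (i, j) = 0" using that upper_triangularD[OF ut, of j i] by (simp add: T'_def)
    thus ?thesis using \<eta>0 L0 by simp
  qed
  have H: "psd n H"
  proof (rule diag_dominant_psd[of _ _ "\<eta> * L"])
    show "H \<in> carrier_mat n n" by (auto simp: H_def intro!: carrier_matI)
    show "mat_adjoint H = H"
      by (rule eq_matI) (auto simp: H_def)
    show "0 \<le> \<eta> * L" using \<eta>0 L0 by simp
  next
    fix i assume i: "i < n"
    have "T' $$ (i, i) = T $$ (i, i)" using i \<eta>0 by (simp add: T'_def)
    thus "real n * (\<eta> * L) \<le> Re (H $$ (i, i))"
      using i small a_le[OF i] by (simp add: H_def)
  next
    fix i j assume ij: "i < n" "j < n" "i \<noteq> j"
    show "cmod (H $$ (i, j)) \<le> \<eta> * L"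
    proof (cases "i < j")
      case True
      hence "T' $$ (j, i) = 0" using ij upper_triangularD[OF ut, of i j] by (simp add: T'_def)
      thus ?thesis using ij T'_off[of i j] by (simp add: H_def)
    next
      case False
      hence "T' $$ (i, j) = 0" using ij upper_triangularD[OF ut, of j i] by (simp add: T'_def)
      thus ?thesis using ij T'_off[of j i] by (simp add: H_def)
    qed
  qed
  define P where "P = mat_adjoint U * U"
  have U: "U \<in> carrier_mat n n" and V: "V \<in> carrier_mat n n" by (auto intro!: carrier_matI)
  have P: "psd n P" unfolding P_def by (rule psd_gram[OF U])
  have [simp]: "dim_row P = n" "dim_col P = n" by (auto simp: P_def)
  obtain c where c: "0 < c" and Vc: "psd n (complex_of_real c \<cdot>\<^sub>m 1\<^sub>m n - mat_adjoint V * V)"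
    using hermitian_le_scalar[OF psd_carrier psd_adjoint, OF psd_gram[OF V] psd_gram[OF V]] .
  have UA': "mat_adjoint A * mat_adjoint U = mat_adjoint U * mat_adjoint T'"
    using arg_cong[OF UA, of mat_adjoint] by (simp add: adjoint_mult)
  have VU': "mat_adjoint U * mat_adjoint V = 1\<^sub>m n"
    using arg_cong[OF VU, of mat_adjoint] by (simp add: adjoint_mult)
  have UA'': "mat_adjoint A * (mat_adjoint U * Z) = mat_adjoint U * (mat_adjoint T' * Z)"
    and VU'': "mat_adjoint U * (mat_adjoint V * Z) = Z" if "dim_row Z = n" for Z
    using UA' VU' that by (simp_all add: mult_assoc_dim[symmetric])
  \<comment> \<open>Semidefiniteness of \<open>H\<close> gives decay of rate \<open>a\<close>
    measured in \<open>P\<close>. As \<open>V\<close> inverts \<open>U\<close>, the bound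
    \<open>V\<^sup>* V \<le> c\<close> yields \<open>P \<ge> 1 / c\<close>, which trades
    \<open>a * P\<close> for a multiple of the identity.\<close>
  have "- (mat_adjoint A * P + P * A) - complex_of_real (a / c) \<cdot>\<^sub>m 1\<^sub>m n = mat_adjoint U * H * U
      + complex_of_real (a / c) \<cdot>\<^sub>m (mat_adjoint U * (complex_of_real c \<cdot>\<^sub>m 1\<^sub>m n - mat_adjoint V * V) * U)"
    by (rule eq_matI)
      (use c in \<open>simp_all add: P_def H_def mat_expand UA UA'' VU VU'' algebra_simps del: index_mult_mat(1)\<close>)
  moreover have "psd n \<dots>"
    using a0 c by (intro psd_add psd_smult psd_congruence[OF H U] psd_congruence[OF Vc U]) auto
  ultimately have "psd n (- (mat_adjoint A * P + P * A) - complex_of_real (a / c) \<cdot>\<^sub>m 1\<^sub>m n)" by simp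
  thus thesis using that[of P "a / c"] P a0 c by simp
qed

text \<open>Stabilizability supplies the start of the Newton iteration: a Lyapunov matrix of the
  stable \<open>A + B * F\<close>, scaled to dominate the running cost
  \<open>1 + F\<^sup>* F\<close> of that feedback, is a Riccati supersolution.\<close>

lemma stabilizable_riccati:
  assumes A: "A \<in> carrier_mat n n" and B: "B \<in> carrier_mat n m" and stab: "stabilizable A B"
  shows "\<exists>!X. psd n X \<and> riccati_solution A B X"
proof -
  have [simp]: "dim_row A = n" "dim_col A = n" "dim_row B = n" "dim_col B = m" using A B by auto
  define G where "G = B * mat_adjoint B"
  have G: "psd n G" using psd_gram[of "mat_adjoint B" m n] B by (simp add: G_def)
  have [simp]: "dim_row G = n" "dim_col G = n" using psd_dim[OF G] by auto
  obtain F where F: "F \<in> carrier_mat m n" and "stable (A + B * F)"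
    using stab by (auto simp: stabilizable_def)
  define M where "M = A + B * F"
  have [simp]: "dim_row F = m" "dim_col F = n" "dim_row M = n" "dim_col M = n" using F by (auto simp: M_def)
  have M: "M \<in> carrier_mat n n" by (auto intro!: carrier_matI)
  obtain P0 c where P0: "psd n P0" and c: "0 < c"
    and lyap: "psd n (- (mat_adjoint M * P0 + P0 * M) - complex_of_real c \<cdot>\<^sub>m 1\<^sub>m n)"
    using stable_lyapunov_strict[OF M] \<open>stable (A + B * F)\<close> by (metis M_def)
  have [simp]: "dim_row P0 = n" "dim_col P0 = n" using psd_dim[OF P0] by auto
  define Q where "Q = 1\<^sub>m n + mat_adjoint F * F"
  have Q: "psd n Q" unfolding Q_def by (intro psd_add psd_one psd_gram[OF F])
  have [simp]: "dim_row Q = n" "dim_col Q = n" using psd_dim[OF Q] by auto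
  obtain d where d: "0 < d" and Qd: "psd n (complex_of_real d \<cdot>\<^sub>m 1\<^sub>m n - Q)"
    using hermitian_le_scalar[OF psd_carrier[OF Q] psd_adjoint[OF Q]] .
  \<comment> \<open>\<open>P0\<close> guarantees decay \<open>c\<close> and the cost is at most
    \<open>d\<close>; the factor \<open>d / c\<close> matches the two.\<close>
  define P where "P = complex_of_real (d / c) \<cdot>\<^sub>m P0"
  have P: "psd n P" unfolding P_def using c d by (intro psd_smult P0) auto
  have [simp]: "dim_row P = n" "dim_col P = n" and [simp]: "mat_adjoint P = P"
    using psd_dim[OF P] psd_adjoint[OF P] by auto
  have 1: "psd n (- (mat_adjoint M * P + P * M) - Q)"
  proof -
    have "- (mat_adjoint M * P + P * M) - Q
        = complex_of_real (d / c) \<cdot>\<^sub>m (- (mat_adjoint M * P0 + P0 * M) - complex_of_real c \<cdot>\<^sub>m 1\<^sub>m n)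
          + (complex_of_real d \<cdot>\<^sub>m 1\<^sub>m n - Q)"
      by (rule eq_matI) (use c in \<open>simp_all add: P_def mat_expand algebra_simps del: index_mult_mat(1)\<close>)
    moreover have "psd n \<dots>" using c d by (intro psd_add psd_smult lyap Qd) auto
    ultimately show ?thesis by simp
  qed
  \<comment> \<open>Completing the square: the deviation of \<open>F\<close> from the feedback
    \<open>- B\<^sup>* P\<close> enters as a semidefinite term.\<close>
  have "P * G * P - (mat_adjoint A * P + P * A) - 1\<^sub>m n = (- (mat_adjoint M * P + P * M) - Q)
      + mat_adjoint (F + mat_adjoint B * P) * (F + mat_adjoint B * P)"
    by (rule eq_matI)
      (simp_all add: M_def Q_def G_def mat_expand algebra_simps del: index_mult_mat(1))
  moreover have "psd n \<dots>"
    by (intro psd_add 1 psd_gram[of _ m]) (auto intro!: carrier_matI)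
  ultimately have super: "psd n (P * G * P - (mat_adjoint A * P + P * A) - 1\<^sub>m n)" by simp
  have ric: "riccati_solution A B X \<longleftrightarrow> X * G * X - X * A - mat_adjoint A * X - 1\<^sub>m n = 0\<^sub>m n n"
    if "psd n X" for X
    using psd_dim[OF that] by (simp add: riccati_solution_def G_def mult_assoc_dim psd_carrier[OF that])
  obtain X where X: "psd n X" "X * G * X - X * A - mat_adjoint A * X - 1\<^sub>m n = 0\<^sub>m n n"
    using riccati_exists_below[OF A G P super] .
  show ?thesis
  proof (rule ex1I)
    show "psd n X \<and> riccati_solution A B X" using X ric by auto
    fix Y assume "psd n Y \<and> riccati_solution A B Y"
    thus "Y = X" using riccati_unique[OF A G] X ric by auto
  qed
qed

lemma lqr_X_spec:
  assumes A: "A \<in> carrier_mat n n" and B: "B \<in> carrier_mat n m" and stab: "stabilizable A B"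
  shows "psd n (lqr_X A B)" "riccati_solution A B (lqr_X A B)"
proof -
  have "nonnegative_mat Y \<and> riccati_solution A B Y \<longleftrightarrow> psd n Y \<and> riccati_solution A B Y" for Y
    using A by (auto simp: psd_iff_nonnegative riccati_solution_def)
  thus "psd n (lqr_X A B)" "riccati_solution A B (lqr_X A B)"
    using theI'[OF stabilizable_riccati[OF assms]] by (simp_all add: lqr_X_def)
qed

section \<open>Decay rates\<close>

text \<open>The trace is the sum over the diagonal of a Schur form. Its \<open>n\<close> entries are
  eigenvalues with negative real part, each at least as far left as the minimum.\<close>

lemma stable_min_decay_le_trace:
  assumes M: "M \<in> carrier_mat n n" and stable: "stable M"
  shows "real n * Min ((\<lambda>\<nu>. \<bar>Re \<nu>\<bar>) ` spectrum M) \<le> - Re (tr M)"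
proof -
  obtain T P Q where T: "T \<in> carrier_mat n n" and P: "P \<in> carrier_mat n n" and Q: "Q \<in> carrier_mat n n"
    and QP: "Q * P = 1\<^sub>m n" and M_eq: "M = P * T * Q"
    and ev: "\<And>i. i < n \<Longrightarrow> eigenvalue M (T $$ (i, i))"
    by (rule schur_complex[OF M]) auto
  have [simp]: "dim_row T = n" "dim_col T = n" "dim_row P = n" "dim_col P = n" "dim_row Q = n" "dim_col Q = n"
    using T P Q by auto
  have "tr M = tr (P * (T * Q))" unfolding M_eq by (simp add: mult_assoc_dim)
  also have "\<dots> = tr (T * (Q * P))" by (subst tr_mult_commute) (simp_all add: mult_assoc_dim)
  also have "\<dots> = (\<Sum>i<n. T $$ (i, i))" unfolding QP by (simp add: tr_def)
  finally have tr: "- Re (tr M) = (\<Sum>i<n. - Re (T $$ (i, i)))" by (simp add: sum_negf)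
  have "(\<Sum>i<n. Min ((\<lambda>\<nu>. \<bar>Re \<nu>\<bar>) ` spectrum M)) \<le> (\<Sum>i<n. - Re (T $$ (i, i)))"
  proof (rule sum_mono)
    fix i assume "i \<in> {..<n}"
    hence i: "eigenvalue M (T $$ (i, i))" using ev by simp
    hence "Min ((\<lambda>\<nu>. \<bar>Re \<nu>\<bar>) ` spectrum M) \<le> \<bar>Re (T $$ (i, i))\<bar>"
      using card_finite_spectrum(1)[OF M] by (intro Min_le) (auto simp: spectrum_def)
    also have "\<dots> = - Re (T $$ (i, i))" using i stable by (auto simp: stable_def)
    finally show "Min ((\<lambda>\<nu>. \<bar>Re \<nu>\<bar>) ` spectrum M) \<le> - Re (T $$ (i, i))" .
  qed
  thus ?thesis unfolding tr by simp
qed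

lemma tr_gram:
  assumes "Y \<in> carrier_mat m n"
  shows "tr (mat_adjoint Y * Y) = complex_of_real (\<Sum>j<n. \<Sum>i<m. (cmod (Y $$ (i, j)))\<^sup>2)"
proof -
  have "tr (mat_adjoint Y * Y) = (\<Sum>j<n. \<Sum>i<m. Y $$ (i, j) * cnj (Y $$ (i, j)))"
    using assms by (simp add: tr_def index_mult_sum mult.commute del: index_mult_mat(1))
  thus ?thesis unfolding of_real_sum complex_norm_square .
qed

text \<open>A supremum of reals bounds the elements of its set only if the set is bounded; most of
  the proof supplies a crude bound through the entries of \<open>B\<close>.\<close>

lemma norm_mult_vec_le_op_norm:
  assumes B: "B \<in> carrier_mat n m" and x: "dim_vec x = m" "vec_norm2 x \<le> 1"
  shows "vec_norm2 (B *\<^sub>v x) \<le> op_norm B"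
  unfolding op_norm_def
proof (rule cSup_upper)
  have [simp]: "dim_row B = n" "dim_col B = m" using B by auto
  show "vec_norm2 (B *\<^sub>v x) \<in> {vec_norm2 (B *\<^sub>v x) |x. x \<in> carrier_vec (dim_col B) \<and> vec_norm2 x \<le> 1}"
    using x by (auto intro!: exI[of _ x] carrier_vecI)
  show "bdd_above {vec_norm2 (B *\<^sub>v x) |x. x \<in> carrier_vec (dim_col B) \<and> vec_norm2 x \<le> 1}"
  proof (rule bdd_aboveI, safe)
    fix y assume y: "y \<in> carrier_vec (dim_col B)" "vec_norm2 y \<le> 1"
    hence [simp]: "dim_vec y = m" by auto
    have le1: "cmod (y $ k) \<le> 1" if "k < m" for k
    proof -
      have "(cmod (y $ k))\<^sup>2 \<le> (\<Sum>k<m. (cmod (y $ k))\<^sup>2)"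
        using that by (intro member_le_sum[of k _ "\<lambda>k. (cmod (y $ k))\<^sup>2"]) auto
      also have "\<dots> \<le> 1" using y(2) by (simp add: vec_norm2_def)
      finally show ?thesis by (simp add: power_le_one_iff)
    qed
    have "cmod ((B *\<^sub>v y) $ i) \<le> (\<Sum>k<m. cmod (B $$ (i, k)))" if "i < n" for i
    proof -
      have "cmod ((B *\<^sub>v y) $ i) \<le> (\<Sum>k<m. cmod (B $$ (i, k) * y $ k))"
        using that by (simp add: index_mult_vec_sum norm_sum del: index_mult_mat_vec)
      also have "\<dots> \<le> (\<Sum>k<m. cmod (B $$ (i, k)))"
        using le1 by (intro sum_mono) (auto simp: norm_mult mult_left_le)
      finally show ?thesis .
    qed
    thus "vec_norm2 (B *\<^sub>v y) \<le> sqrt (\<Sum>i<n. (\<Sum>k<m. cmod (B $$ (i, k)))\<^sup>2)"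
      unfolding vec_norm2_def by (auto intro!: sum_mono power_mono simp del: index_mult_mat_vec)
  qed
qed

text \<open>Every column is the image of a unit vector, so each of the \<open>m\<close> columns
  contributes at most \<open>(op_norm B)\<^sup>2\<close>.\<close>

lemma frobenius_le_op_norm:
  assumes B: "B \<in> carrier_mat n m"
  shows "(\<Sum>j<m. \<Sum>i<n. (cmod (B $$ (i, j)))\<^sup>2) \<le> real m * (op_norm B)\<^sup>2"
proof -
  have "(\<Sum>i<n. (cmod (B $$ (i, j)))\<^sup>2) \<le> (op_norm B)\<^sup>2" if j: "j < m" for j
  proof -
    have "vec_norm2 (unit_vec m j) = sqrt (\<Sum>i\<in>{j}. (cmod (unit_vec m j $ i))\<^sup>2)"
      unfolding vec_norm2_def by (rule arg_cong[of _ _ sqrt], rule sum.mono_neutral_right) (use j in auto)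
    hence 1: "vec_norm2 (unit_vec m j) = 1" using j by simp
    have "B *\<^sub>v unit_vec m j = col B j"
      using B j by (intro eq_vecI) auto
    hence "vec_norm2 (col B j) \<le> op_norm B"
      using norm_mult_vec_le_op_norm[OF B, of "unit_vec m j"] 1 by simp
    moreover have "vec_norm2 (col B j) = sqrt (\<Sum>i<n. (cmod (B $$ (i, j)))\<^sup>2)"
      using B j by (auto simp: vec_norm2_def)
    ultimately show ?thesis by (metis real_sqrt_le_iff sqrt_le_D)
  qed
  hence "(\<Sum>j<m. \<Sum>i<n. (cmod (B $$ (i, j)))\<^sup>2) \<le> (\<Sum>j<m. (op_norm B)\<^sup>2)"
    by (intro sum_mono) auto
  thus ?thesis by simp
qed

text \<open>Since \<open>A\<close> is skew-Hermitian, the trace of the Riccati equation gives \<open>tr (X B B\<^sup>* X) = n\<close>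
  exactly, and \<open>n \<gamma> \<le> Re (tr (B B\<^sup>* X))\<close> is bounded by the Frobenius norms of \<open>B\<close> and
  \<open>B\<^sup>* X\<close>.\<close>

lemma gamma_decay_le:
  assumes A: "A \<in> carrier_mat n n" "skew_hermitian A" and n: "0 < n"
    and B: "B \<in> carrier_mat n m" "stabilizable A B" and r: "0 < r" "real m * (op_norm B)\<^sup>2 = real n * r\<^sup>2"
  shows "gamma_decay A B \<le> r"
proof -
  define X where "X = lqr_X A B"
  have X: "psd n X" and ric: "riccati_solution A B X"
    using lqr_X_spec[OF A(1) B] by (auto simp: X_def)
  have [simp]: "dim_row A = n" "dim_col A = n" "dim_row B = n" "dim_col B = m" "dim_row X = n" "dim_col X = n"
    and [simp]: "mat_adjoint X = X" and skew: "mat_adjoint A = - A"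
    using A B psd_dim[OF X] psd_adjoint[OF X] by (auto simp: skew_hermitian_def)
  have G: "psd n (B * mat_adjoint B)" using psd_gram[of "mat_adjoint B" m n] B by simp
  define Y where "Y = mat_adjoint B * X"
  have Y: "Y \<in> carrier_mat m n" and [simp]: "dim_row Y = m" "dim_col Y = n"
    by (auto simp: Y_def intro!: carrier_matI)
  have ric': "X * (B * mat_adjoint B) * X - X * A - mat_adjoint A * X - 1\<^sub>m n = 0\<^sub>m n n"
    using ric by (simp add: riccati_solution_def mult_assoc_dim)
  have stable: "stable (A - B * mat_adjoint B * X)"
    by (rule riccati_closed_loop_stable[OF A(1) G X ric'])
  have "tr (X * (B * mat_adjoint B) * X - X * A - mat_adjoint A * X - 1\<^sub>m n) = 0"
    unfolding ric' by (simp add: tr_def)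
  moreover have "X * (B * mat_adjoint B) * X = mat_adjoint Y * Y"
    by (simp add: Y_def mat_expand)
  \<comment> \<open>With \<open>mat_adjoint A = - A\<close>, the two linear terms of the Riccati
    equation have opposite traces and cancel.\<close>
  moreover have "tr (X * A) = tr (A * X)" by (rule tr_mult_commute) simp_all
  moreover have "tr (1\<^sub>m n) = complex_of_real n" by (simp add: tr_def)
  ultimately have "tr (mat_adjoint Y * Y) = complex_of_real n"
    by (simp add: tr_linear skew)
  hence froY: "(\<Sum>j<n. \<Sum>i<m. (cmod (Y $$ (i, j)))\<^sup>2) = real n"
    unfolding tr_gram[OF Y] using of_real_eq_iff by blast
  have "Re (tr A) = 0"
  proof -
    have "Re (A $$ (i, i)) = 0" if "i < n" for i
      using arg_cong[OF skew, of "\<lambda>Z. Z $$ (i, i)"] that by (simp add: complex_eq_iff)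
    thus ?thesis by (simp add: tr_def)
  qed
  hence "- Re (tr (A - B * mat_adjoint B * X)) = Re (tr (B * Y))"
    by (simp add: tr_linear Y_def mult_assoc_dim)
  also have "\<dots> = (\<Sum>i<n. \<Sum>k<m. Re (B $$ (i, k) * Y $$ (k, i)))"
    by (simp add: tr_def index_mult_sum del: index_mult_mat(1) times_complex.sel)
  \<comment> \<open>The weight \<open>r\<close> balances the two sums: each contributes at most
    \<open>n * r / 2\<close>.\<close>
  also have "\<dots> \<le> (\<Sum>i<n. \<Sum>k<m. (cmod (B $$ (i, k)))\<^sup>2 / (2 * r) + r * (cmod (Y $$ (k, i)))\<^sup>2 / 2)"
  proof (intro sum_mono)
    fix i k
    define b y where "b = cmod (B $$ (i, k))" and "y = cmod (Y $$ (k, i))"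
    have "Re (B $$ (i, k) * Y $$ (k, i)) \<le> b * y"
      unfolding b_def y_def norm_mult[symmetric] by (rule complex_Re_le_cmod)
    also have "b * y \<le> b\<^sup>2 / (2 * r) + r * y\<^sup>2 / 2"
    proof -
      have "0 \<le> (b - r * y)\<^sup>2 / (2 * r)" using r by simp
      also have "\<dots> = b\<^sup>2 / (2 * r) + r * y\<^sup>2 / 2 - b * y"
        using r by (simp add: power2_eq_square field_simps)
      finally show ?thesis by simp
    qed
    finally show "Re (B $$ (i, k) * Y $$ (k, i)) \<le> (cmod (B $$ (i, k)))\<^sup>2 / (2 * r) + r * (cmod (Y $$ (k, i)))\<^sup>2 / 2"
      by (simp add: b_def y_def)
  qed
  also have "\<dots> = (\<Sum>j<m. \<Sum>i<n. (cmod (B $$ (i, j)))\<^sup>2) / (2 * r) + r * (\<Sum>j<n. \<Sum>i<m. (cmod (Y $$ (i, j)))\<^sup>2) / 2"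
    by (simp add: sum.distrib sum_divide_distrib sum_distrib_left sum.swap[of _ "{..<m}" "{..<n}"])
  also have "\<dots> \<le> real n * r\<^sup>2 / (2 * r) + r * real n / 2"
    unfolding froY using frobenius_le_op_norm[OF B(1)] r by (intro add_mono divide_right_mono) auto
  also have "\<dots> = real n * r" using r by (simp add: power2_eq_square)
  finally have "- Re (tr (A - B * mat_adjoint B * X)) \<le> real n * r" .
  moreover have "A - B * mat_adjoint B * X \<in> carrier_mat n n" by (auto intro!: carrier_matI)
  ultimately have "real n * gamma_decay A B \<le> real n * r"
    using stable_min_decay_le_trace[OF _ stable, of n]
    unfolding gamma_decay_def closed_loop_def X_def[symmetric] by linarith
  thus ?thesis using n by simp
qed

section \<open>The Riccati equation for a large spectral gap\<close>

lemma sum_mult_le_L2: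
  fixes f g :: "'a \<Rightarrow> complex"
  shows "cmod (\<Sum>i\<in>S. f i * g i) \<le> L2_set (\<lambda>i. cmod (f i)) S * L2_set (\<lambda>i. cmod (g i)) S"
proof -
  have "cmod (\<Sum>i\<in>S. f i * g i) \<le> (\<Sum>i\<in>S. \<bar>cmod (f i)\<bar> * \<bar>cmod (g i)\<bar>)"
    using norm_sum[of "\<lambda>i. f i * g i" S] by (simp add: norm_mult)
  also have "\<dots> \<le> L2_set (\<lambda>i. cmod (f i)) S * L2_set (\<lambda>i. cmod (g i)) S"
    by (rule L2_set_mult_ineq)
  finally show ?thesis .
qed

text \<open>In coordinates of the eigenbasis of \<open>A\<close>, \<open>f\<close>, \<open>x\<close> and \<open>y\<close>
  are the entries of \<open>B\<close>, \<open>X\<close> and \<open>B\<^sup>* X\<close>. The diagonal of the Riccati equation says that the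
  columns of \<open>y\<close> are unit vectors, so the other entries give \<open>\<bar>x\<^sub>j\<^sub>k\<bar> \<le> 1 / \<delta>\<close>.\<close>

lemma riccati_large_gap:
  fixes f x y :: "nat \<Rightarrow> nat \<Rightarrow> complex" and u :: "nat \<Rightarrow> complex" and lam :: "nat \<Rightarrow> real"
  assumes r: "0 < r" and \<delta>: "0 < \<delta>" "2 * real n * r \<le> \<delta>" "real m * (real n * r) \<le> \<delta>"
    and rows: "\<And>j. j < n \<Longrightarrow> (\<Sum>l<m. (cmod (f j l))\<^sup>2) = r\<^sup>2"
    and gap: "\<And>j k. j < n \<Longrightarrow> k < n \<Longrightarrow> j \<noteq> k \<Longrightarrow> \<delta> \<le> \<bar>lam j - lam k\<bar>"
    and y: "\<And>l j. l < m \<Longrightarrow> j < n \<Longrightarrow> y l j = (\<Sum>k<n. cnj (f k l) * x k j)"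
    and ric: "\<And>j k. j < n \<Longrightarrow> k < n \<Longrightarrow>
      (\<Sum>l<m. cnj (y l j) * y l k) + \<i> * complex_of_real (lam j - lam k) * x j k = (if j = k then 1 else 0)"
    and diag: "\<And>j. j < n \<Longrightarrow> Im (x j j) = 0" "\<And>j. j < n \<Longrightarrow> 0 \<le> Re (x j j)"
    and u: "\<exists>j<n. u j \<noteq> 0"
    and ev: "\<And>j. j < n \<Longrightarrow>
      \<i> * complex_of_real (lam j) * u j - (\<Sum>k<n. (\<Sum>l<m. f j l * y l k) * u k) = \<nu> * u j"
  shows "Re \<nu> \<le> - r + (2 * real m * real n * r\<^sup>2 + 2 * (real n)\<^sup>2 * r\<^sup>2) / \<delta>"
proof -
  have n: "0 < n" using u by auto
  have Lf: "L2_set (\<lambda>l. cmod (f j l)) {..<m} = r" if "j < n" for j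
    using rows[OF that] r by (simp add: L2_set_def)
  have Ly: "L2_set (\<lambda>l. cmod (y l j)) {..<m} = 1" and self: "(\<Sum>l<m. cnj (y l j) * y l j) = 1" if "j < n" for j
  proof -
    show "(\<Sum>l<m. cnj (y l j) * y l j) = 1" using ric[OF that that] by simp
    hence "(\<Sum>l<m. y l j * cnj (y l j)) = 1" by (simp add: mult.commute)
    hence "complex_of_real (\<Sum>l<m. (cmod (y l j))\<^sup>2) = 1"
      unfolding of_real_sum complex_norm_square .
    thus "L2_set (\<lambda>l. cmod (y l j)) {..<m} = 1"
      by (metis L2_set_def of_real_eq_1_iff real_sqrt_one)
  qed
  have off: "cmod (x j k) \<le> 1 / \<delta>" if "j < n" "k < n" "j \<noteq> k" for j k
  proof -
    have "\<i> * complex_of_real (lam j - lam k) * x j k = - (\<Sum>l<m. cnj (y l j) * y l k)"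
      using ric[OF that(1,2)] that(3) by (simp add: eq_neg_iff_add_eq_0 add.commute)
    hence "\<bar>lam j - lam k\<bar> * cmod (x j k) = cmod (\<Sum>l<m. cnj (y l j) * y l k)"
      by (metis norm_minus_cancel norm_mult norm_ii mult_1 norm_of_real)
    also have "\<dots> \<le> 1"
      using sum_mult_le_L2[of "\<lambda>l. cnj (y l j)" "\<lambda>l. y l k" "{..<m}"] Ly that by simp
    finally have "\<bar>lam j - lam k\<bar> * cmod (x j k) \<le> 1" .
    moreover have "\<delta> * cmod (x j k) \<le> \<bar>lam j - lam k\<bar> * cmod (x j k)"
      using gap[OF that] by (intro mult_right_mono) auto
    ultimately show ?thesis using \<delta>(1) by (simp add: field_simps)
  qed
  have f_le: "cmod (f k l) \<le> r" if "k < n" "l < m" for k l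
    using member_le_L2_set[of "{..<m}" l "\<lambda>l. cmod (f k l)"] Lf that by simp
  define g where "g j k = (\<Sum>l<m. f j l * y l k)" for j k
  have g_le: "cmod (g j k) \<le> r" if "j < n" "k < n" for j k
    unfolding g_def using sum_mult_le_L2[of "f j" "\<lambda>l. y l k" "{..<m}"] Lf Ly that by simp
  \<comment> \<open>A bound for the sum of the \<open>cmod (e l)\<close> below: \<open>m\<close>
    terms, each at most \<open>n * r / \<delta>\<close>. The last hypothesis on \<delta> says that
    it is at most 1.\<close>
  define \<eta> where "\<eta> = real m * (real n * r) / \<delta>"
  have \<eta>0: "0 \<le> \<eta>" and \<eta>1: "\<eta> \<le> 1" using r \<delta> by (auto simp: \<eta>_def)
  have g_diag: "r * (1 - 2 * \<eta>) \<le> Re (g j j)" if j: "j < n" for j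
  proof -
    define t where "t = Re (x j j)"
    have xt: "x j j = complex_of_real t" using diag(1)[OF j] by (simp add: t_def complex_eq_iff)
    have t0: "0 \<le> t" using diag(2)[OF j] by (simp add: t_def)
    \<comment> \<open>The contribution of the off-diagonal entries of \<open>x\<close> to column
      \<open>j\<close> of \<open>y\<close>. Up to \<open>e\<close>, this column is \<open>t\<close>
      times the conjugate of row \<open>j\<close> of \<open>f\<close>.\<close>
    define e where "e l = (\<Sum>k\<in>{..<n} - {j}. cnj (f k l) * x k j)" for l
    have y_split: "y l j = cnj (f j l) * complex_of_real t + e l" if "l < m" for l
      unfolding y[OF that j] e_def xt[symmetric] using j by (simp add: sum.remove[of _ j])
    have e_le: "cmod (e l) \<le> real n * r / \<delta>" if l: "l < m" for l
    proof -
      have "cmod (e l) \<le> (\<Sum>k\<in>{..<n} - {j}. r * (1 / \<delta>))"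
        unfolding e_def by (rule sum_norm_le)
          (use f_le[OF _ l] off[OF _ j] r in \<open>auto simp: norm_mult intro!: mult_mono simp del: times_divide_eq_right\<close>)
      also have "\<dots> \<le> real n * r / \<delta>"
        using r \<delta>(1) j by (simp add: divide_right_mono mult_right_mono)
      finally show ?thesis .
    qed
    have e_sum: "(\<Sum>l<m. cmod (e l)) \<le> \<eta>"
      using sum_mono[of "{..<m}" "\<lambda>l. cmod (e l)" "\<lambda>l. real n * r / \<delta>"] e_le by (simp add: \<eta>_def)
    \<comment> \<open>Comparison of lengths bounds \<open>t\<close> from above: \<open>t\<close>
      times a row of length \<open>r\<close> differs from a unit vector by at most \<eta>.\<close>
    have "t * r = L2_set (\<lambda>l. t * cmod (f j l)) {..<m}"
      using L2_set_right_distrib[OF t0, of "\<lambda>l. cmod (f j l)" "{..<m}"] Lf[OF j] by simp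
    also have "\<dots> \<le> L2_set (\<lambda>l. cmod (y l j) + cmod (e l)) {..<m}"
    proof (rule L2_set_mono)
      fix l assume "l \<in> {..<m}"
      hence "cnj (f j l) * complex_of_real t = y l j - e l" using y_split by simp
      hence "cmod (f j l) * t \<le> cmod (y l j) + cmod (e l)"
        by (metis norm_triangle_ineq4 norm_mult complex_mod_cnj norm_of_real abs_of_nonneg t0)
      thus "t * cmod (f j l) \<le> cmod (y l j) + cmod (e l)" by (simp add: mult.commute)
    qed (use t0 in auto)
    also have "\<dots> \<le> L2_set (\<lambda>l. cmod (y l j)) {..<m} + L2_set (\<lambda>l. cmod (e l)) {..<m}"
      by (rule L2_set_triangle_ineq)
    also have "\<dots> \<le> 1 + \<eta>"
      using Ly[OF j] e_sum L2_set_le_sum[of "{..<m}" "\<lambda>l. cmod (e l)"] by simp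
    finally have tr_le: "t * r \<le> 1 + \<eta>" .
    \<comment> \<open>Expanding only one factor of the squared length of column \<open>j\<close>
      leaves \<open>g j j\<close>, the diagonal entry of the feedback term, as the coefficient of
      \<open>t\<close>.\<close>
    have "1 = (\<Sum>l<m. (f j l * complex_of_real t + cnj (e l)) * y l j)"
    proof -
      have "(\<Sum>l<m. cnj (y l j) * y l j) = (\<Sum>l<m. (f j l * complex_of_real t + cnj (e l)) * y l j)"
        by (rule sum.cong) (simp_all add: y_split)
      thus ?thesis using self[OF j] by simp
    qed
    also have "\<dots> = complex_of_real t * g j j + (\<Sum>l<m. cnj (e l) * y l j)"
      by (simp add: g_def sum_distrib_left sum.distrib algebra_simps)
    finally have "Re 1 = Re (complex_of_real t * g j j + (\<Sum>l<m. cnj (e l) * y l j))"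
      by (rule arg_cong)
    hence "1 = t * Re (g j j) + Re (\<Sum>l<m. cnj (e l) * y l j)"
      by (simp del: Re_sum)
    moreover have "Re (\<Sum>l<m. cnj (e l) * y l j) \<le> \<eta>"
    proof -
      have "Re (\<Sum>l<m. cnj (e l) * y l j) \<le> L2_set (\<lambda>l. cmod (e l)) {..<m}"
        using complex_Re_le_cmod[of "\<Sum>l<m. cnj (e l) * y l j"]
          sum_mult_le_L2[of "\<lambda>l. cnj (e l)" "\<lambda>l. y l j" "{..<m}"] Ly[OF j] by simp
      also have "\<dots> \<le> \<eta>" using e_sum L2_set_le_sum[of "{..<m}" "\<lambda>l. cmod (e l)"] by simp
      finally show ?thesis .
    qed
    ultimately have tg: "1 - \<eta> \<le> t * Re (g j j)" by simp
    show ?thesis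
    \<comment> \<open>For \<open>\<eta> = 1\<close>, \<open>tg\<close> does not make
      \<open>Re (g j j)\<close> positive, but the claim is then only
      \<open>- r \<le> Re (g j j)\<close>. Otherwise
      \<open>(1 - 2 * \<eta>) * (1 + \<eta>) \<le> 1 - \<eta>\<close> leads to the claim without
      dividing by \<open>t\<close>.\<close>
    proof (cases "\<eta> = 1")
      case True
      have "- r \<le> Re (g j j)"
        using g_le[OF j j] abs_Re_le_cmod[of "g j j"] by linarith
      thus ?thesis using True by simp
    next
      case False
      hence "0 < t * Re (g j j)" using tg \<eta>1 by simp
      hence g0: "0 < Re (g j j)" using t0 by (simp add: zero_less_mult_iff)
      have "r * (1 - 2 * \<eta>) * (1 + \<eta>) \<le> r * (1 - \<eta>)"
        using r \<eta>0 by (simp add: algebra_simps)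
      also have "\<dots> \<le> r * (t * Re (g j j))" using tg r by simp
      also have "\<dots> = (t * r) * Re (g j j)" by simp
      also have "\<dots> \<le> (1 + \<eta>) * Re (g j j)" using tr_le g0 by (intro mult_right_mono) auto
      finally show ?thesis using \<eta>0 by (simp add: mult.commute)
    qed
  qed
  \<comment> \<open>As in Gershgorin's theorem, the row of the largest component of the eigenvector
    locates \<nu> near \<open>\<i> * lam p\<close>.\<close>
  obtain p where p: "p < n" and max: "\<And>k. k < n \<Longrightarrow> cmod (u k) \<le> cmod (u p)"
  proof -
    have "Max ((\<lambda>k. cmod (u k)) ` {..<n}) \<in> (\<lambda>k. cmod (u k)) ` {..<n}"
      using n by (intro Max_in) auto
    then obtain p where "p < n" "Max ((\<lambda>k. cmod (u k)) ` {..<n}) = cmod (u p)" by auto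
    thus thesis using that[of p] by (metis Max_ge finite_imageI finite_lessThan imageI lessThan_iff)
  qed
  have up: "0 < cmod (u p)" using u max by (metis norm_le_zero_iff not_le order_trans zero_less_norm_iff)
  have dist: "cmod (\<nu> - \<i> * complex_of_real (lam j)) * cmod (u j) \<le> real n * r * cmod (u p)" if j: "j < n" for j
  proof -
    have "(\<nu> - \<i> * complex_of_real (lam j)) * u j = - (\<Sum>k<n. g j k * u k)"
      using ev[OF j] by (simp add: g_def algebra_simps)
    hence "cmod (\<nu> - \<i> * complex_of_real (lam j)) * cmod (u j) = cmod (\<Sum>k<n. g j k * u k)"
      by (metis norm_minus_cancel norm_mult)
    also have "\<dots> \<le> (\<Sum>k<n. r * cmod (u p))"
      by (rule sum_norm_le) (use g_le[OF j] max r in \<open>auto simp: norm_mult intro!: mult_mono\<close>)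
    finally show ?thesis by simp
  qed
  have near: "cmod (\<nu> - \<i> * complex_of_real (lam p)) \<le> real n * r"
    using dist[OF p] up by simp
  \<comment> \<open>\<nu> is within \<open>n * r \<le> \<delta> / 2\<close> of
    \<open>\<i> * lam p\<close>, hence at least \<open>\<delta> / 2\<close> away from every other
    \<open>\<i> * lam k\<close>; row \<open>k\<close> of the eigenvalue equation then forces
    \<open>u k\<close> to be small.\<close>
  have small: "cmod (u k) \<le> 2 * real n * r / \<delta> * cmod (u p)" if k: "k < n" "k \<noteq> p" for k
  proof -
    have "\<delta> \<le> cmod (\<i> * complex_of_real (lam p - lam k))"
      using gap[OF p k(1)] k(2) by (simp add: norm_mult del: of_real_diff)
    also have "\<i> * complex_of_real (lam p - lam k)
        = (\<nu> - \<i> * complex_of_real (lam k)) - (\<nu> - \<i> * complex_of_real (lam p))"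
      by (simp add: algebra_simps)
    also have "cmod \<dots> \<le> cmod (\<nu> - \<i> * complex_of_real (lam k)) + real n * r"
      using norm_triangle_ineq4[of "\<nu> - \<i> * complex_of_real (lam k)" "\<nu> - \<i> * complex_of_real (lam p)"] near
      by linarith
    finally have "\<delta> / 2 \<le> cmod (\<nu> - \<i> * complex_of_real (lam k))" using \<delta>(2) by simp
    hence "\<delta> / 2 * cmod (u k) \<le> cmod (\<nu> - \<i> * complex_of_real (lam k)) * cmod (u k)"
      by (intro mult_right_mono) auto
    also note dist[OF k(1)]
    finally show ?thesis using \<delta>(1) by (simp add: field_simps)
  qed
  define s where "s = (\<Sum>k\<in>{..<n} - {p}. g p k * u k)"
  have s_le: "cmod s \<le> real n * (r * (2 * real n * r / \<delta> * cmod (u p)))"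
  proof -
    have "cmod s \<le> (\<Sum>k\<in>{..<n} - {p}. r * (2 * real n * r / \<delta> * cmod (u p)))"
      unfolding s_def
    proof (rule sum_norm_le)
      fix k assume "k \<in> {..<n} - {p}"
      thus "cmod (g p k * u k) \<le> r * (2 * real n * r / \<delta> * cmod (u p))"
        unfolding norm_mult using g_le[OF p] small r by (intro mult_mono) auto
    qed
    also have "\<dots> = real (n - 1) * (r * (2 * real n * r / \<delta> * cmod (u p)))"
      using p by simp
    also have "\<dots> \<le> real n * (r * (2 * real n * r / \<delta> * cmod (u p)))"
      using r \<delta>(1) by (intro mult_right_mono) auto
    finally show ?thesis .
  qed
  \<comment> \<open>Dividing row \<open>p\<close> by \<open>u p\<close> isolates \<nu>, and
    \<open>\<i> * lam p\<close> drops out of its real part. The two error terms are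
    \<open>2 * r * \<eta>\<close> from \<open>g_diag\<close> and
    \<open>2 * n\<^sup>2 * r\<^sup>2 / \<delta>\<close> from the small components.\<close>
  have "(\<nu> - \<i> * complex_of_real (lam p)) * u p = - (g p p * u p + s)"
    using ev[OF p] p by (simp add: g_def s_def sum.remove[of _ p] algebra_simps)
  hence "\<nu> = \<i> * complex_of_real (lam p) - g p p - s / u p"
    using up by (simp add: field_simps)
  hence "Re \<nu> = - Re (g p p) - Re (s / u p)" by simp
  also have "\<dots> \<le> - (r * (1 - 2 * \<eta>)) + cmod (s / u p)"
    using g_diag[OF p] abs_Re_le_cmod[of "s / u p"] by linarith
  also have "cmod (s / u p) \<le> real n * (r * (2 * real n * r / \<delta>))"
    using s_le up by (simp add: norm_divide field_simps)
  also have "- (r * (1 - 2 * \<eta>)) + real n * (r * (2 * real n * r / \<delta>))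
      = - r + (2 * real m * real n * r\<^sup>2 + 2 * (real n)\<^sup>2 * r\<^sup>2) / \<delta>"
    using \<delta>(1) by (simp add: \<eta>_def field_simps power2_eq_square)
  finally show ?thesis by simp
qed

section \<open>Passage to the eigenbasis\<close>

lemma eigenbasis_diagonalizes:
  fixes lam :: "nat \<Rightarrow> real"
  assumes A: "A \<in> carrier_mat n n" and basis: "eigenbasis n A lam v"
  defines "V \<equiv> mat_of_cols n (map v [0..<n])"
    and "D \<equiv> mat_diag n (\<lambda>j. \<i> * complex_of_real (lam j))"
  shows "V \<in> carrier_mat n n" "mat_adjoint V * V = 1\<^sub>m n" "V * mat_adjoint V = 1\<^sub>m n" "A * V = V * D"
proof -
  have v: "v j \<in> carrier_vec n" "A *\<^sub>v v j = (\<i> * complex_of_real (lam j)) \<cdot>\<^sub>v v j" if "j < n" for j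
    using basis that by (auto simp: eigenbasis_def)
  have orth: "v j \<bullet>c v k = (if j = k then 1 else 0)" if "j < n" "k < n" for j k
    using basis that by (auto simp: eigenbasis_def)
  have dv: "dim_vec (v j) = n" if "j < n" for j using v(1)[OF that] by simp
  show V: "V \<in> carrier_mat n n" by (auto simp: V_def intro!: carrier_matI)
  have [simp]: "dim_row V = n" "dim_col V = n" "dim_row A = n" "dim_col A = n" "dim_row D = n" "dim_col D = n"
    using V A by (auto simp: D_def mat_diag_def)
  have V_index: "V $$ (i, j) = v j $ i" if "i < n" "j < n" for i j
    using that by (simp add: V_def mat_of_cols_index)
  show "mat_adjoint V * V = 1\<^sub>m n"
  proof (rule eq_matI)
    fix i j assume "i < dim_row (1\<^sub>m n :: complex mat)" "j < dim_col (1\<^sub>m n :: complex mat)"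
    hence ij: "i < n" "j < n" by auto
    have "(mat_adjoint V * V) $$ (i, j) = v j \<bullet>c v i"
      using ij by (simp add: index_mult_sum cscalar_sum V_index dv mult.commute del: index_mult_mat(1))
    thus "(mat_adjoint V * V) $$ (i, j) = 1\<^sub>m n $$ (i, j)" using orth ij by simp
  qed auto
  thus "V * mat_adjoint V = 1\<^sub>m n"
    using mat_mult_left_right_inverse[of "mat_adjoint V" n V] V by simp
  show "A * V = V * D"
  proof (rule eq_matI)
    fix i j assume "i < dim_row (V * D)" "j < dim_col (V * D)"
    hence ij: "i < n" "j < n" by auto
    have "(A * V) $$ (i, j) = (A *\<^sub>v v j) $ i"
      using ij by (simp add: index_mult_sum index_mult_vec_sum V_index dv
          del: index_mult_mat(1) index_mult_mat_vec)
    also have "\<dots> = (V * D) $$ (i, j)"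
      unfolding v(2)[OF ij(2)] D_def mat_diag_mult_right[OF V] using ij by (simp add: V_index dv)
    finally show "(A * V) $$ (i, j) = (V * D) $$ (i, j)" .
  qed auto
qed

lemma spectral_gap_le:
  assumes "j < n" "k < n" "j \<noteq> k"
  shows "spectral_gap n lam \<le> \<bar>lam j - lam k\<bar>"
proof -
  have "{\<bar>lam j - lam k\<bar> |j k. j < n \<and> k < n \<and> j \<noteq> k} \<subseteq> (\<lambda>(j, k). \<bar>lam j - lam k\<bar>) ` ({..<n} \<times> {..<n})"
    by auto
  hence "finite {\<bar>lam j - lam k\<bar> |j k. j < n \<and> k < n \<and> j \<noteq> k}"
    by (rule finite_subset) auto
  thus ?thesis unfolding spectral_gap_def using assms by (intro Min_le) auto
qed

text \<open>The feedback \<open>- B\<^sup>*\<close> works. As \<open>A\<close> is skew-Hermitian, an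
  eigenvector \<open>x\<close> satisfies
  \<open>Re \<nu> * (x \<bullet>c x) = - (z \<bullet>c z)\<close> with
  \<open>z = B\<^sup>* x\<close>. If \<open>Re \<nu> \<ge> 0\<close>, then \<open>z = 0\<close> and
  \<open>x\<close> is an eigenvector of \<open>A\<close>, hence a multiple of a single
  \<open>v p\<close>. But then \<open>z\<close> is a nonzero multiple of the conjugate of row
  \<open>p\<close> of \<open>F\<close>.\<close>

lemma stabilizable_if_distinct_eigenvalues:
  fixes lam :: "nat \<Rightarrow> real"
  assumes A: "A \<in> carrier_mat n n" "skew_hermitian A" and basis: "eigenbasis n A lam v"
    and distinct: "\<And>j k. j < n \<Longrightarrow> k < n \<Longrightarrow> j \<noteq> k \<Longrightarrow> lam j \<noteq> lam k"
    and F: "F \<in> carrier_mat n m" and nonzero: "\<And>j. j < n \<Longrightarrow> \<exists>l<m. F $$ (j, l) \<noteq> 0"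
  shows "stabilizable A (mat_of_cols n (map v [0..<n]) * F)"
proof -
  define V where "V = mat_of_cols n (map v [0..<n])"
  define D where "D = mat_diag n (\<lambda>j. \<i> * complex_of_real (lam j))"
  note V = eigenbasis_diagonalizes[OF A(1) basis, folded V_def D_def]
  define B where "B = V * F"
  have [simp]: "dim_row V = n" "dim_col V = n" "dim_row A = n" "dim_col A = n" "dim_row D = n" "dim_col D = n"
    "dim_row F = n" "dim_col F = m" "dim_row B = n" "dim_col B = m"
    and skew: "mat_adjoint A = - A"
    using V(1) A F by (auto simp: D_def B_def mat_diag_def skew_hermitian_def)
  have M: "A + B * (- mat_adjoint B) \<in> carrier_mat n n" by (auto intro!: carrier_matI)
  have "stable (A + B * (- mat_adjoint B))"
    unfolding stable_def
  proof (intro allI impI)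
    fix \<nu> assume "eigenvalue (A + B * (- mat_adjoint B)) \<nu>"
    then obtain x where x [simp]: "dim_vec x = n" and x0: "x \<noteq> 0\<^sub>v n"
      and eq: "(A + B * (- mat_adjoint B)) *\<^sub>v x = \<nu> \<cdot>\<^sub>v x"
      using eigenvalueE M by metis
    define z where "z = mat_adjoint B *\<^sub>v x"
    have dz [simp]: "dim_vec z = m" by (simp add: z_def)
    have eq': "A *\<^sub>v x - B *\<^sub>v z = \<nu> \<cdot>\<^sub>v x"
    proof -
      have "A *\<^sub>v x - B *\<^sub>v z = (A + B * (- mat_adjoint B)) *\<^sub>v x"
        by (simp only: z_def, rule eq_vecI) (simp_all add: vec_expand uminus_mult_dim del: index_mult_mat_vec)
      thus ?thesis using eq by simp
    qed
    have Bz: "(B *\<^sub>v z) \<bullet>c x = z \<bullet>c z"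
      using adjoint_cscalar[of z "mat_adjoint B" x] by (simp add: z_def)
    have "(A *\<^sub>v x) \<bullet>c x = - cnj ((A *\<^sub>v x) \<bullet>c x)"
    proof -
      have "(mat_adjoint A *\<^sub>v x) \<bullet>c x = x \<bullet>c (A *\<^sub>v x)" by (rule adjoint_cscalar) simp_all
      moreover have "x \<bullet>c (A *\<^sub>v x) = cnj ((A *\<^sub>v x) \<bullet>c x)"
        by (simp add: cscalar_sum mult.commute del: index_mult_mat_vec)
      ultimately show ?thesis unfolding skew by (simp add: cscalar_linear eq_neg_iff_add_eq_0 add.commute neg_eq_iff_add_eq_0)
    qed
    hence Re_A: "Re ((A *\<^sub>v x) \<bullet>c x) = 0" by (simp add: complex_eq_iff)
    have "(A *\<^sub>v x - B *\<^sub>v z) \<bullet>c x = \<nu> * (x \<bullet>c x)"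
      unfolding eq' by (simp add: cscalar_linear)
    hence "Re ((A *\<^sub>v x) \<bullet>c x - z \<bullet>c z) = Re (\<nu> * (x \<bullet>c x))"
      by (simp only: cscalar_linear Bz dim_mult_mat_vec x \<open>dim_row A = n\<close> \<open>dim_row B = n\<close>)
    moreover have "Im (x \<bullet>c x) = 0" by (simp only: cscalar_self) simp
    ultimately have balance: "Re \<nu> * Re (x \<bullet>c x) = - Re (z \<bullet>c z)" using Re_A by simp
    show "Re \<nu> < 0"
    proof (rule ccontr)
      assume "\<not> ?thesis"
      hence "0 \<le> Re \<nu> * Re (x \<bullet>c x)" using Re_cscalar_self_nonneg[of x] by simp
      hence "Re (z \<bullet>c z) = 0" using balance Re_cscalar_self_nonneg[of z] by linarith
      hence z0: "z = 0\<^sub>v m" using Re_cscalar_self_pos[OF dz] by (metis less_irrefl)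
      hence "B *\<^sub>v z = 0\<^sub>v n" by (intro eq_vecI) (auto simp: index_mult_vec_sum simp del: index_mult_mat_vec)
      hence Ax: "A *\<^sub>v x = \<nu> \<cdot>\<^sub>v x"
      proof -
        have "A *\<^sub>v x - 0\<^sub>v n = A *\<^sub>v x" by (rule eq_vecI) auto
        thus ?thesis using eq' \<open>B *\<^sub>v z = 0\<^sub>v n\<close> by simp
      qed
      define u where "u = mat_adjoint V *\<^sub>v x"
      have du [simp]: "dim_vec u = n" by (simp add: u_def)
      have Vu: "V *\<^sub>v u = x"
      proof -
        have "V *\<^sub>v u = (V * mat_adjoint V) *\<^sub>v x" unfolding u_def by (rule mult_vec_assoc_dim[symmetric]) simp_all
        thus ?thesis unfolding V(3) using one_mult_mat_vec[OF carrier_vecI[OF x]] by simp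
      qed
      have Vinj: "mat_adjoint V *\<^sub>v (V *\<^sub>v y) = y" if "dim_vec y = n" for y
        using that one_mult_mat_vec[OF carrier_vecI[OF that]] by (simp add: mult_vec_assoc_dim[symmetric] V(2))
      have "V *\<^sub>v (D *\<^sub>v u) = A *\<^sub>v (V *\<^sub>v u)"
        by (simp add: mult_vec_assoc_dim[symmetric] V(4))
      also have "\<dots> = V *\<^sub>v (\<nu> \<cdot>\<^sub>v u)" by (simp add: Vu Ax vec_expand)
      finally have Du: "D *\<^sub>v u = \<nu> \<cdot>\<^sub>v u"
        by (metis Vinj dim_mult_mat_vec du index_smult_vec(2) \<open>dim_row D = n\<close>)
      have comp: "\<i> * complex_of_real (lam j) * u $ j = \<nu> * u $ j" if "j < n" for j
      proof -
        have "(D *\<^sub>v u) $ j = (\<Sum>k<n. D $$ (j, k) * u $ k)"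
          using that by (simp add: index_mult_vec_sum del: index_mult_mat_vec)
        also have "\<dots> = (\<Sum>k\<in>{j}. D $$ (j, k) * u $ k)"
          by (rule sum.mono_neutral_right) (use that in \<open>auto simp: D_def mat_diag_def\<close>)
        finally have "(D *\<^sub>v u) $ j = D $$ (j, j) * u $ j" by simp
        moreover have "D $$ (j, j) = \<i> * complex_of_real (lam j)" using that by (simp add: D_def mat_diag_def)
        ultimately show ?thesis using that unfolding Du by auto
      qed
      have "u \<noteq> 0\<^sub>v n"
      proof
        assume "u = 0\<^sub>v n"
        hence "x = 0\<^sub>v n" unfolding Vu[symmetric]
          by (intro eq_vecI) (auto simp: index_mult_vec_sum simp del: index_mult_mat_vec)
        thus False using x0 by simp
      qed
      then obtain p where p: "p < n" "u $ p \<noteq> 0"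
        using du by (metis eq_vecI index_zero_vec(1,2))
      have others: "u $ k = 0" if "k < n" "k \<noteq> p" for k
      proof (rule ccontr)
        assume "u $ k \<noteq> 0"
        hence "\<i> * complex_of_real (lam k) = \<i> * complex_of_real (lam p)"
          using comp[OF p(1)] comp[OF that(1)] p(2) by simp
        hence "lam k = lam p" by simp
        thus False using distinct[OF that(1) p(1) that(2)] by simp
      qed
      obtain l where l: "l < m" "F $$ (p, l) \<noteq> 0" using nonzero[OF p(1)] by auto
      have "z = mat_adjoint F *\<^sub>v u"
        by (simp add: z_def B_def adjoint_mult mult_vec_assoc_dim u_def)
      hence "z $ l = (\<Sum>k<n. cnj (F $$ (k, l)) * u $ k)"
        using l by (simp add: index_mult_vec_sum del: index_mult_mat_vec)
      also have "\<dots> = (\<Sum>k\<in>{p}. cnj (F $$ (k, l)) * u $ k)"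
        by (rule sum.mono_neutral_right) (use p others in auto)
      also have "\<dots> \<noteq> 0" using p l by simp
      finally show False using z0 l by simp
    qed
  qed
  thus ?thesis
    unfolding stabilizable_def V_def[symmetric] B_def[symmetric]
    by (intro bexI[of _ "- mat_adjoint B"]) (auto intro!: carrier_matI)
qed

text \<open>Conjugation by the unitary \<open>V\<close> replaces \<open>A\<close> by the diagonal
  \<open>D\<close>, \<open>B\<close> by \<open>F\<close> and the closed loop by
  \<open>D - F * Y\<close>; read entry by entry, this gives the hypotheses of
  \<open>riccati_large_gap\<close>.\<close>

lemma closed_loop_eigenvalue_large_gap:
  fixes lam :: "nat \<Rightarrow> real"
  assumes A: "A \<in> carrier_mat n n" and basis: "eigenbasis n A lam v"
    and gap: "\<And>j k. j < n \<Longrightarrow> k < n \<Longrightarrow> j \<noteq> k \<Longrightarrow> \<delta> \<le> \<bar>lam j - lam k\<bar>"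
    and F: "F \<in> carrier_mat n m" and rows: "\<And>j. j < n \<Longrightarrow> (\<Sum>l<m. (cmod (F $$ (j, l)))\<^sup>2) = r\<^sup>2"
    and r: "0 < r" and \<delta>: "0 < \<delta>" "2 * real n * r \<le> \<delta>" "real m * (real n * r) \<le> \<delta>"
  defines "B \<equiv> mat_of_cols n (map v [0..<n]) * F"
  assumes stab: "stabilizable A B" and ev: "eigenvalue (closed_loop A B) \<nu>"
  shows "Re \<nu> \<le> - r + (2 * real m * real n * r\<^sup>2 + 2 * (real n)\<^sup>2 * r\<^sup>2) / \<delta>"
proof -
  define V where "V = mat_of_cols n (map v [0..<n])"
  define D where "D = mat_diag n (\<lambda>j. \<i> * complex_of_real (lam j))"
  note V = eigenbasis_diagonalizes[OF A(1) basis, folded V_def D_def]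
  have B_eq: "B = V * F" by (simp add: B_def V_def)
  have dims [simp]: "dim_row V = n" "dim_col V = n" "dim_row A = n" "dim_col A = n" "dim_row D = n" "dim_col D = n"
    "dim_row F = n" "dim_col F = m" "dim_row B = n" "dim_col B = m"
    using V(1) A F by (auto simp: D_def B_eq mat_diag_def)
  define X where "X = lqr_X A B"
  have B: "B \<in> carrier_mat n m" by (auto intro!: carrier_matI)
  have X: "psd n X" and ric: "riccati_solution A B X"
    using lqr_X_spec[OF A B stab] by (auto simp: X_def)
  define X' where "X' = mat_adjoint V * X * V"
  have X': "psd n X'" unfolding X'_def by (rule psd_congruence[OF X V(1)])
  define Y where "Y = mat_adjoint F * X'"
  have [simp]: "dim_row X = n" "dim_col X = n" "dim_row X' = n" "dim_col X' = n" "dim_row Y = m" "dim_col Y = n"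
    and [simp]: "mat_adjoint X = X" "mat_adjoint X' = X'"
    using psd_dim[OF X] psd_adjoint[OF X] psd_dim[OF X'] psd_adjoint[OF X'] by (auto simp: Y_def)
  have VV: "mat_adjoint V * (V * Z) = Z" "V * (mat_adjoint V * Z) = Z" if "dim_row Z = n" for Z
    using that V(2,3) by (simp_all add: mult_assoc_dim[symmetric])
  have AV: "mat_adjoint V * mat_adjoint A = mat_adjoint D * mat_adjoint V"
    using arg_cong[OF V(4), of mat_adjoint] by (simp add: adjoint_mult)
  have AV': "mat_adjoint V * (mat_adjoint A * Z) = mat_adjoint D * (mat_adjoint V * Z)" if "dim_row Z = n" for Z
    using that AV by (simp add: mult_assoc_dim[symmetric])
  have ric': "mat_adjoint Y * Y - X' * D - mat_adjoint D * X' - 1\<^sub>m n = 0\<^sub>m n n"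
  proof -
    have "mat_adjoint Y * Y - X' * D - mat_adjoint D * X' - 1\<^sub>m n
      = mat_adjoint V * (X * B * mat_adjoint B * X - X * A - mat_adjoint A * X - 1\<^sub>m n) * V"
      by (rule eq_matI)
        (simp_all add: Y_def X'_def B_eq mat_expand VV V(2-4) AV' del: index_mult_mat(1))
    also have "\<dots> = 0\<^sub>m n n"
      using ric by (simp add: riccati_solution_def)
    finally show ?thesis .
  qed
  have D_mult: "(X' * D) $$ (j, k) = X' $$ (j, k) * (\<i> * complex_of_real (lam k))"
    "(mat_adjoint D * X') $$ (j, k) = - (\<i> * complex_of_real (lam j)) * X' $$ (j, k)" if "j < n" "k < n" for j k
  proof -
    have "mat_adjoint D = mat_diag n (\<lambda>j. - (\<i> * complex_of_real (lam j)))"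
      by (rule eq_matI) (auto simp: D_def mat_diag_def)
    thus "(X' * D) $$ (j, k) = X' $$ (j, k) * (\<i> * complex_of_real (lam k))"
      "(mat_adjoint D * X') $$ (j, k) = - (\<i> * complex_of_real (lam j)) * X' $$ (j, k)"
      using that
      by (simp_all add: D_def mat_diag_mult_right[OF psd_carrier[OF X']] mat_diag_mult_left[OF psd_carrier[OF X']])
  qed
  have closed_eq: "closed_loop A B = A - B * mat_adjoint B * X" by (simp add: closed_loop_def X_def)
  have closed: "closed_loop A B \<in> carrier_mat n n" by (auto simp: closed_eq intro!: carrier_matI)
  obtain x where x [simp]: "dim_vec x = n" and x0: "x \<noteq> 0\<^sub>v n" and eq: "closed_loop A B *\<^sub>v x = \<nu> \<cdot>\<^sub>v x"
    using eigenvalueE[OF ev closed] by metis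
  define u where "u = mat_adjoint V *\<^sub>v x"
  have du [simp]: "dim_vec u = n" by (simp add: u_def)
  have Vu: "V *\<^sub>v u = x"
  proof -
    have "V *\<^sub>v u = (V * mat_adjoint V) *\<^sub>v x" unfolding u_def by (rule mult_vec_assoc_dim[symmetric]) simp_all
    thus ?thesis unfolding V(3) using one_mult_mat_vec[OF carrier_vecI[OF x]] by simp
  qed
  have conj: "mat_adjoint V * closed_loop A B * V = D - F * Y"
    unfolding closed_eq
    by (rule eq_matI)
      (simp_all add: Y_def X'_def B_eq mat_expand VV V(2-4) del: index_mult_mat(1))
  have "(D - F * Y) *\<^sub>v u = mat_adjoint V *\<^sub>v (closed_loop A B *\<^sub>v x)"
    unfolding conj[symmetric] Vu[symmetric] using carrier_matD[OF closed] by (simp add: mult_vec_assoc_dim)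
  also have "\<dots> = \<nu> \<cdot>\<^sub>v u" unfolding eq u_def by (simp add: vec_expand)
  finally have eq_u: "(D - F * Y) *\<^sub>v u = \<nu> \<cdot>\<^sub>v u" .
  show ?thesis
  proof (rule riccati_large_gap[where f = "\<lambda>j l. F $$ (j, l)" and x = "\<lambda>j k. X' $$ (j, k)"
        and y = "\<lambda>l j. Y $$ (l, j)" and u = "\<lambda>j. u $ j" and lam = lam, OF r \<delta>])
    fix l j assume "l < m" "j < n"
    thus "Y $$ (l, j) = (\<Sum>k<n. cnj (F $$ (k, l)) * X' $$ (k, j))"
      by (simp add: Y_def index_mult_sum del: index_mult_mat(1))
  next
    fix j k assume jk: "j < n" "k < n"
    have "(mat_adjoint Y * Y) $$ (j, k) = (\<Sum>l<m. cnj (Y $$ (l, j)) * Y $$ (l, k))"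
      using jk by (simp add: index_mult_sum del: index_mult_mat(1))
    thus "(\<Sum>l<m. cnj (Y $$ (l, j)) * Y $$ (l, k)) + \<i> * complex_of_real (lam j - lam k) * X' $$ (j, k)
        = (if j = k then 1 else 0)"
      using arg_cong[OF ric', of "\<lambda>Z. Z $$ (j, k)"] jk D_mult[OF jk]
      by (simp add: algebra_simps del: index_mult_mat(1) split: if_splits)
  next
    fix j assume j: "j < n"
    show "Im (X' $$ (j, j)) = 0"
      using hermitian_entry[OF psd_adjoint[OF X'], of j j] j by (simp add: complex_eq_iff)
    show "0 \<le> Re (X' $$ (j, j))" by (rule psd_diag_nonneg[OF X' j])
  next
    have "u \<noteq> 0\<^sub>v n"
    proof
      assume "u = 0\<^sub>v n"
      hence "x = 0\<^sub>v n" unfolding Vu[symmetric]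
        by (intro eq_vecI) (auto simp: index_mult_vec_sum simp del: index_mult_mat_vec)
      thus False using x0 by simp
    qed
    thus "\<exists>j<n. u $ j \<noteq> 0"
      using du by (metis eq_vecI index_zero_vec(1,2))
  next
    fix j assume j: "j < n"
    have "(\<Sum>k<n. D $$ (j, k) * u $ k) = (\<Sum>k\<in>{j}. D $$ (j, k) * u $ k)"
      by (rule sum.mono_neutral_right) (use j in \<open>auto simp: D_def mat_diag_def\<close>)
    hence Du: "(D *\<^sub>v u) $ j = \<i> * complex_of_real (lam j) * u $ j"
      using j by (simp add: index_mult_vec_sum D_def mat_diag_def del: index_mult_mat_vec)
    have "((D - F * Y) *\<^sub>v u) $ j = (D *\<^sub>v u) $ j - ((F * Y) *\<^sub>v u) $ j"
      using j by (simp add: minus_mult_vec_dim del: index_mult_mat_vec)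
    also have "((F * Y) *\<^sub>v u) $ j = (\<Sum>k<n. (\<Sum>l<m. F $$ (j, l) * Y $$ (l, k)) * u $ k)"
      using j by (simp add: index_mult_vec_sum index_mult_sum del: index_mult_mat_vec index_mult_mat(1))
    finally show "\<i> * complex_of_real (lam j) * u $ j - (\<Sum>k<n. (\<Sum>l<m. F $$ (j, l) * Y $$ (l, k)) * u $ k)
        = \<nu> * u $ j"
      using j unfolding eq_u Du by simp
  qed (use rows gap in auto)
qed

section \<open>The scaled discrete Fourier matrix\<close>

definition dft_mat :: "nat \<Rightarrow> nat \<Rightarrow> real \<Rightarrow> complex mat" where
  "dft_mat n m \<beta> = mat n m (\<lambda>(j, l). complex_of_real (\<beta> / sqrt (real n)) *
     exp (- (\<i> * complex_of_real (2 * pi / real n))) ^ (j * l))"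

lemma dft_carrier: "dft_mat n m \<beta> \<in> carrier_mat n m"
  by (simp add: dft_mat_def)

lemma B_hat_eq: "B_hat n m \<beta> v = mat_of_cols n (map v [0..<n]) * dft_mat n m \<beta>"
  by (simp add: B_hat_def dft_mat_def Let_def)

lemma norm_dft_entry:
  assumes "0 < \<beta>" "j < n" "l < m"
  shows "cmod (dft_mat n m \<beta> $$ (j, l)) = \<beta> / sqrt (real n)"
  using assms by (simp add: dft_mat_def norm_mult norm_power norm_divide)

text \<open>Every entry is a multiple of a geometric sum in an \<open>n\<close>-th root of unity.
  Off the diagonal this root differs from 1, since the column indices are distinct and below
  \<open>m \<le> n\<close>, so the sum vanishes.\<close>

lemma dft_gram:
  assumes "m \<le> n" "0 < n"
  shows "mat_adjoint (dft_mat n m \<beta>) * dft_mat n m \<beta> = complex_of_real (\<beta>\<^sup>2) \<cdot>\<^sub>m 1\<^sub>m m"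
proof (rule eq_matI)
  fix k l assume "k < dim_row (complex_of_real (\<beta>\<^sup>2) \<cdot>\<^sub>m 1\<^sub>m m)" "l < dim_col (complex_of_real (\<beta>\<^sup>2) \<cdot>\<^sub>m 1\<^sub>m m)"
  hence kl: "k < m" "l < m" by auto
  define w where "w = exp (- (\<i> * complex_of_real (2 * pi / real n)))"
  \<comment> \<open>This is \<open>w\<close> to the power \<open>l - k\<close>;
    \<open>cnj w\<close>, the inverse of \<open>w\<close>, avoids a negative exponent.\<close>
  define \<zeta> where "\<zeta> = cnj w ^ k * w ^ l"
  have w_cis: "w = cis (- (2 * pi / real n))" by (simp add: w_def cis_conv_exp)
  have w1: "cnj w * w = 1" by (simp add: w_cis cis_cnj cis_mult)
  have wn: "w ^ n = 1" using assms(2) by (simp add: w_cis DeMoivre complex_eq_iff)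
  have "(mat_adjoint (dft_mat n m \<beta>) * dft_mat n m \<beta>) $$ (k, l)
      = (\<Sum>j<n. complex_of_real (\<beta>\<^sup>2 / real n) * \<zeta> ^ j)"
  proof -
    have "cnj (dft_mat n m \<beta> $$ (j, k)) * dft_mat n m \<beta> $$ (j, l) = complex_of_real (\<beta>\<^sup>2 / real n) * \<zeta> ^ j"
      if "j < n" for j
    proof -
      have entry: "dft_mat n m \<beta> $$ (j, i) = complex_of_real (\<beta> / sqrt (real n)) * w ^ (j * i)" if "i < m" for i
        using that \<open>j < n\<close> by (simp add: dft_mat_def w_def)
      have "complex_of_real (\<beta> / sqrt (real n)) * complex_of_real (\<beta> / sqrt (real n)) = complex_of_real (\<beta>\<^sup>2 / real n)"
        unfolding of_real_mult[symmetric] by (simp add: power2_eq_square)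
      moreover have "cnj w ^ (j * k) * w ^ (j * l) = \<zeta> ^ j"
        by (simp add: \<zeta>_def power_mult_distrib power_mult[symmetric] mult.commute)
      ultimately show ?thesis
        unfolding entry[OF kl(1)] entry[OF kl(2)] complex_cnj_mult complex_cnj_power complex_cnj_complex_of_real
        by (metis mult.assoc mult.left_commute)
    qed
    thus ?thesis
      using kl carrier_matD[OF dft_carrier[of n m \<beta>]] by (simp add: index_mult_sum del: index_mult_mat(1))
  qed
  also have "\<dots> = complex_of_real (\<beta>\<^sup>2 / real n) * (\<Sum>j<n. \<zeta> ^ j)" by (simp add: sum_distrib_left)
  also have "\<dots> = complex_of_real (\<beta>\<^sup>2) * (if k = l then 1 else 0)"
  proof (cases "k = l")
    case True
    hence "\<zeta> = 1" by (simp add: \<zeta>_def power_mult_distrib[symmetric] w1)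
    thus ?thesis using True assms(2) by simp
  next
    case False
    \<comment> \<open>Equal powers would give cosine 1 at the angle
      \<open>2 * pi * (b - a) / n\<close>, so \<open>n\<close> would divide \<open>b - a\<close>,
      which lies strictly between 0 and \<open>n\<close>.\<close>
    have inj: "w ^ a \<noteq> w ^ b" if "a < b" "b < n" for a b
    proof
      assume "w ^ a = w ^ b"
      moreover have "w ^ b = w ^ a * w ^ (b - a)" using that by (simp flip: power_add)
      moreover have "w \<noteq> 0" by (simp add: w_def)
      ultimately have "w ^ (b - a) = 1" by simp
      moreover have "w ^ (b - a) = cis (- (2 * pi * real (b - a) / real n))"
        by (simp add: w_cis DeMoivre mult_ac)
      ultimately have "cos (2 * pi * real (b - a) / real n) = 1"
        by (metis cis.sel(1) cos_minus one_complex.sel(1))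
      then obtain i :: int where "2 * pi * real (b - a) / real n = of_int i * 2 * pi"
        using cos_one_2pi_int by auto
      hence "real (b - a) = of_int i * real n"
        using assms(2) by (simp add: field_simps)
      hence "int (b - a) = i * int n" by (metis of_int_eq_iff of_int_mult of_int_of_nat_eq)
      hence "int n dvd int (b - a)" by simp
      hence "n dvd b - a" by simp
      thus False using that by (auto dest: dvd_imp_le)
    qed
    have "\<zeta> \<noteq> 1"
    proof
      assume "\<zeta> = 1"
      hence "w ^ k * (cnj w ^ k * w ^ l) = w ^ k" by (simp add: \<zeta>_def)
      hence "(cnj w * w) ^ k * w ^ l = w ^ k" by (simp add: power_mult_distrib mult_ac)
      hence "w ^ l = w ^ k" by (simp add: w1)
      thus False using inj[of k l] inj[of l k] False kl assms(1) by (metis less_le_trans nat_neq_iff)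
    qed
    moreover have "\<zeta> ^ n = 1"
    proof -
      have "\<zeta> ^ n = cnj (w ^ n) ^ k * (w ^ n) ^ l"
        by (simp add: \<zeta>_def power_mult_distrib power_mult[symmetric] mult.commute)
      thus ?thesis by (simp add: wn)
    qed
    ultimately have "(\<Sum>j<n. \<zeta> ^ j) = 0" by (simp add: geometric_sum)
    thus ?thesis using False by simp
  qed
  finally show "(mat_adjoint (dft_mat n m \<beta>) * dft_mat n m \<beta>) $$ (k, l)
      = (complex_of_real (\<beta>\<^sup>2) \<cdot>\<^sub>m 1\<^sub>m m) $$ (k, l)"
    using kl by simp
qed (auto simp: dft_mat_def)

lemma norm_scaled_isometry:
  assumes B: "B \<in> carrier_mat n m" and gram: "mat_adjoint B * B = complex_of_real (\<beta>\<^sup>2) \<cdot>\<^sub>m 1\<^sub>m m"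
    and \<beta>: "0 \<le> \<beta>" and x: "dim_vec x = m"
  shows "vec_norm2 (B *\<^sub>v x) = \<beta> * vec_norm2 x"
proof -
  have [simp]: "dim_row B = n" "dim_col B = m" using B by auto
  have "(B *\<^sub>v x) \<bullet>c (B *\<^sub>v x) = (mat_adjoint B *\<^sub>v (B *\<^sub>v x)) \<bullet>c x"
    using x by (intro adjoint_cscalar[symmetric]) auto
  also have "\<dots> = ((mat_adjoint B * B) *\<^sub>v x) \<bullet>c x"
    using x by (simp add: mult_vec_assoc_dim)
  also have "\<dots> = complex_of_real (\<beta>\<^sup>2) * (x \<bullet>c x)"
    unfolding gram using x one_mult_mat_vec[OF carrier_vecI[OF x]] by (simp add: vec_expand cscalar_linear)
  finally have "complex_of_real (\<Sum>i<n. (cmod ((B *\<^sub>v x) $ i))\<^sup>2)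
      = complex_of_real (\<beta>\<^sup>2 * (\<Sum>i<m. (cmod (x $ i))\<^sup>2))"
    using x unfolding cscalar_self by simp
  hence "(\<Sum>i<n. (cmod ((B *\<^sub>v x) $ i))\<^sup>2) = \<beta>\<^sup>2 * (\<Sum>i<m. (cmod (x $ i))\<^sup>2)"
    using of_real_eq_iff by blast
  thus ?thesis
    using \<beta> x by (simp add: vec_norm2_def real_sqrt_mult del: index_mult_mat_vec)
qed

text \<open>All vectors are stretched by the same factor, so the supremum is attained at any unit
  vector, and \<open>0 < m\<close> provides one.\<close>

lemma op_norm_scaled_isometry:
  assumes B: "B \<in> carrier_mat n m" and gram: "mat_adjoint B * B = complex_of_real (\<beta>\<^sup>2) \<cdot>\<^sub>m 1\<^sub>m m"
    and \<beta>: "0 \<le> \<beta>" and m: "0 < m"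
  shows "op_norm B = \<beta>"
  unfolding op_norm_def
proof (rule cSup_eq_maximum)
  note iso = norm_scaled_isometry[OF B gram \<beta>]
  have [simp]: "dim_col B = m" using B by auto
  have "vec_norm2 (unit_vec m 0) = sqrt (\<Sum>i\<in>{0}. (cmod (unit_vec m 0 $ i))\<^sup>2)"
    unfolding vec_norm2_def by (rule arg_cong[of _ _ sqrt], rule sum.mono_neutral_right) (use m in auto)
  hence 1: "vec_norm2 (unit_vec m 0) = 1" using m by simp
  show "\<beta> \<in> {vec_norm2 (B *\<^sub>v x) |x. x \<in> carrier_vec (dim_col B) \<and> vec_norm2 x \<le> 1}"
    using 1 iso[of "unit_vec m 0"] by (auto intro!: exI[of _ "unit_vec m 0"])
  fix y assume "y \<in> {vec_norm2 (B *\<^sub>v x) |x. x \<in> carrier_vec (dim_col B) \<and> vec_norm2 x \<le> 1}"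
  thus "y \<le> \<beta>" using iso \<beta> by (auto simp: mult_left_le)
qed

lemma kernel_scaled_isometry:
  assumes B: "B \<in> carrier_mat n m" and gram: "mat_adjoint B * B = complex_of_real (\<beta>\<^sup>2) \<cdot>\<^sub>m 1\<^sub>m m"
    and \<beta>: "0 < \<beta>"
  shows "mat_kernel B = {0\<^sub>v m}"
proof -
  have [simp]: "dim_row B = n" "dim_col B = m" using B by auto
  have zero: "B *\<^sub>v 0\<^sub>v m = 0\<^sub>v n"
    by (rule eq_vecI) (auto simp: index_mult_vec_sum simp del: index_mult_mat_vec)
  have "x = 0\<^sub>v m" if x: "dim_vec x = m" and Bx: "B *\<^sub>v x = 0\<^sub>v n" for x
  proof -
    have "\<beta> * vec_norm2 x = 0"
      using norm_scaled_isometry[OF B gram _ x] \<beta> by (simp add: Bx vec_norm2_def)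
    hence "Re (x \<bullet>c x) = 0"
      using \<beta> unfolding cscalar_self by (simp add: vec_norm2_def)
    thus ?thesis using Re_cscalar_self_pos[OF x] by force
  qed
  thus ?thesis using zero by (auto simp: mat_kernel_def)
qed

section \<open>The gap threshold and the comparison of both bounds\<close>

theorem theorem12:
  fixes n m :: nat and \<beta> :: real
  assumes "n \<ge> 2" and "1 \<le> m" and "m \<le> n" and "\<beta> > 0"
  shows "(\<forall>A lam v. A \<in> carrier_mat n n \<and> skew_hermitian A \<and> eigenbasis n A lam v \<longrightarrow>
            op_norm (B_hat n m \<beta> v) = \<beta>) \<and>
         (\<forall>\<epsilon>>0. \<exists>K>0. \<forall>A lam v.
            A \<in> carrier_mat n n \<and> skew_hermitian A \<and> eigenbasis n A lam v \<and>
            spectral_gap n lam > K \<longrightarrow>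
              B_hat n m \<beta> v \<in> admissible n m A \<and>
              (SUP B\<in>{B \<in> admissible n m A. op_norm B = \<beta>}. ereal (gamma_decay A B))
                - ereal (gamma_decay A (B_hat n m \<beta> v)) < ereal \<epsilon>)"
proof -
  have n: "0 < n" and m: "0 < m" using assms by auto
  have B_hat_carrier: "B_hat n m \<beta> v \<in> carrier_mat n m" for v
    unfolding B_hat_eq using dft_carrier[of n m \<beta>] by (auto intro!: carrier_matI)
  have gram: "mat_adjoint (B_hat n m \<beta> v) * B_hat n m \<beta> v = complex_of_real (\<beta>\<^sup>2) \<cdot>\<^sub>m 1\<^sub>m m"
    if "A \<in> carrier_mat n n" "eigenbasis n A lam v" for A lam v
  proof -
    note V = eigenbasis_diagonalizes[OF that]
    have [simp]: "dim_row (dft_mat n m \<beta>) = n" "dim_col (dft_mat n m \<beta>) = m"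
      using dft_carrier[of n m \<beta>] by auto
    have "mat_adjoint (B_hat n m \<beta> v) * B_hat n m \<beta> v = mat_adjoint (dft_mat n m \<beta>) *
        ((mat_adjoint (mat_of_cols n (map v [0..<n])) * mat_of_cols n (map v [0..<n])) * dft_mat n m \<beta>)"
      unfolding B_hat_eq by (simp add: mat_expand)
    also have "\<dots> = mat_adjoint (dft_mat n m \<beta>) * dft_mat n m \<beta>"
      unfolding V(2) by simp
    finally show ?thesis using dft_gram[OF assms(3) n] by simp
  qed
  \<comment> \<open>The common length of the rows of the Fourier matrix; \<open>r2\<close>
    identifies it with the upper bound in \<open>gamma_decay_le\<close>.\<close>
  define r where "r = \<beta> * sqrt (real m / real n)"
  have r: "0 < r" using assms n by (simp add: r_def)
  have r2: "real m * \<beta>\<^sup>2 = real n * r\<^sup>2" using n by (simp add: r_def power_mult_distrib)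
  have rows: "(\<Sum>l<m. (cmod (dft_mat n m \<beta> $$ (j, l)))\<^sup>2) = r\<^sup>2" if "j < n" for j
    using that assms(4) n by (simp add: norm_dft_entry r_def power_divide power_mult_distrib)
  define c where "c = 2 * real m * real n * r\<^sup>2 + 2 * (real n)\<^sup>2 * r\<^sup>2"
  have asymptotic: "\<exists>K>0. \<forall>A lam v.
      A \<in> carrier_mat n n \<and> skew_hermitian A \<and> eigenbasis n A lam v \<and> spectral_gap n lam > K \<longrightarrow>
        B_hat n m \<beta> v \<in> admissible n m A \<and>
        (SUP B\<in>{B \<in> admissible n m A. op_norm B = \<beta>}. ereal (gamma_decay A B))
          - ereal (gamma_decay A (B_hat n m \<beta> v)) < ereal \<epsilon>" if \<epsilon>: "\<epsilon> > 0" for \<epsilon>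
  proof -
    have c: "0 < c" using r n m by (simp add: c_def add_pos_pos)
    \<comment> \<open>The first two summands secure the size conditions of the large gap estimate,
      and the third makes its error \<open>c / K\<close> at most \<open>\<epsilon> / 2\<close>. The
      estimate is applied with \<open>K\<close> in place of the actual gap, so it is uniform in
      \<open>A\<close>.\<close>
    define K where "K = 2 * real n * r + real m * (real n * r) + 2 * c / \<epsilon>"
    have terms: "0 < 2 * real n * r" "0 < real m * (real n * r)" "0 < 2 * c / \<epsilon>"
      using r n m c \<epsilon> by auto
    have K: "0 < K" "2 * real n * r \<le> K" "real m * (real n * r) \<le> K" using terms unfolding K_def by linarith+
    have "2 * c / \<epsilon> \<le> K" unfolding K_def using terms by linarith
    hence "2 * c \<le> K * \<epsilon>" using \<epsilon> by (simp add: pos_divide_le_eq)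
    hence "c / K < \<epsilon>" using K(1) c by (simp add: pos_divide_less_eq mult.commute)
    show ?thesis
    proof (intro exI[of _ K] conjI allI impI K(1))
      fix A lam v
      assume hyp: "A \<in> carrier_mat n n \<and> skew_hermitian A \<and> eigenbasis n A lam v \<and> spectral_gap n lam > K"
      hence A: "A \<in> carrier_mat n n" "skew_hermitian A" and basis: "eigenbasis n A lam v" by auto
      have gap: "K \<le> \<bar>lam j - lam k\<bar>" if "j < n" "k < n" "j \<noteq> k" for j k
        using hyp spectral_gap_le[OF that, of lam] by simp
      have stab: "stabilizable A (B_hat n m \<beta> v)"
        unfolding B_hat_eq
      proof (rule stabilizable_if_distinct_eigenvalues[OF A basis _ dft_carrier])
        fix j k assume "j < n" "k < n" "j \<noteq> k"
        thus "lam j \<noteq> lam k" using gap[of j k] K(1) by auto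
      next
        fix j assume "j < n"
        thus "\<exists>l<m. dft_mat n m \<beta> $$ (j, l) \<noteq> 0"
          using norm_dft_entry[OF assms(4), of j n 0 m] m n assms(4) by (intro exI[of _ 0]) auto
      qed
      show adm: "B_hat n m \<beta> v \<in> admissible n m A"
        unfolding admissible_def
        using B_hat_carrier stab kernel_scaled_isometry[OF B_hat_carrier gram[OF A(1) basis] assms(4)] by simp
      have upper: "(SUP B\<in>{B \<in> admissible n m A. op_norm B = \<beta>}. ereal (gamma_decay A B)) \<le> ereal r"
        by (rule SUP_least) (use gamma_decay_le[OF A n _ _ r] r2 in \<open>auto simp: admissible_def\<close>)
      define M where "M = closed_loop A (B_hat n m \<beta> v)"
      have M: "M \<in> carrier_mat n n"
        using A(1) B_hat_carrier[of v] psd_dim[OF lqr_X_spec(1)[OF A(1) B_hat_carrier stab]]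
        by (auto simp: M_def closed_loop_def intro!: carrier_matI)
      \<comment> \<open>The minimum is attained at some eigenvalue \<nu>, and
        \<open>\<bar>Re \<nu>\<bar> \<ge> - Re \<nu> \<ge> r - c / K\<close>.\<close>
      have "gamma_decay A (B_hat n m \<beta> v) \<in> (\<lambda>\<nu>. \<bar>Re \<nu>\<bar>) ` spectrum M"
        unfolding gamma_decay_def M_def[symmetric]
        using card_finite_spectrum(1)[OF M] spectrum_non_empty[OF M n] by (intro Min_in) auto
      then obtain \<nu> where \<nu>: "eigenvalue M \<nu>" "gamma_decay A (B_hat n m \<beta> v) = \<bar>Re \<nu>\<bar>"
        by (auto simp: spectrum_def)
      have "Re \<nu> \<le> - r + c / K"
        unfolding c_def
        by (rule closed_loop_eigenvalue_large_gap[OF A(1) basis gap dft_carrier rows r K])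
          (use stab \<nu>(1) in \<open>auto simp: B_hat_eq M_def\<close>)
      hence "r - gamma_decay A (B_hat n m \<beta> v) < \<epsilon>" using \<nu>(2) \<open>c / K < \<epsilon>\<close> by linarith
      moreover have "(SUP B\<in>{B \<in> admissible n m A. op_norm B = \<beta>}. ereal (gamma_decay A B))
          - ereal (gamma_decay A (B_hat n m \<beta> v)) \<le> ereal r - ereal (gamma_decay A (B_hat n m \<beta> v))"
        by (rule ereal_minus_mono[OF upper order_refl])
      ultimately show "(SUP B\<in>{B \<in> admissible n m A. op_norm B = \<beta>}. ereal (gamma_decay A B))
          - ereal (gamma_decay A (B_hat n m \<beta> v)) < ereal \<epsilon>"
        by (simp add: le_less_trans)
    qed
  qed
  show ?thesis
    using asymptotic op_norm_scaled_isometry[OF B_hat_carrier gram less_imp_le[OF assms(4)] m] by blast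
qed

end
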